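(* Let $(M,\omega,g_{\mathcal H})$ be a $3$-dimensional contact sub-Riemannian manifold, $\Omega\subset M$ a domain, and let $E\subset\Omega$ be a set of prescribed mean curvature $f\in C(\Omega)$ with Lipschitz boundary $\Sigma$ in $\Omega$. Then the characteristic curves in $\Sigma\setminus\Sigma_0$ are $\nabla$-geodesics of curvature $H$, where $H=g(\nabla_ZZ,\nu_h)$ is the mean curvature of $\Sigma$; that is, every such curve $\gamma$ satisfies $$\nabla_{\dot\gamma}\dot\gamma+H\,J(\dot\gamma)=0 .$$
   Context: Contact sub-Riemannian manifold: $M$ is a smooth $3$-manifold with a contact form $\omega$, $\mathcal H=\ker\omega$ is the horizontal distribution (so $d\omega|_{\mathcal H}$ is non-degenerate), and $g_{\mathcal H}$ is a sub-Riemannian metric, i.e. a Riemannian metric on $\mathcal H$. The Reeb field $T$ is the unique vector field with $\omega(T)=1$, $\mathcal L_T\omega=0$. The metric $g_{\mathcal H}$ is extended to the Riemannian metric $g$ on $M$ for which $T$ is a unit vector orthogonal to $\mathcal H$; $dM$ is its Riemannian volume (which coincides with Popp's measure) and $D$ its Levi-Civita connection. $M$ is oriented by $\omega\wedge d\omega$. The operators $J$ and $\tau$: these are the antisymmetric and symmetric parts of the endomorphism $V\mapsto D_VT$ of $TM$, that is, $2g(J(V),W)=g(D_VT,W)-g(D_WT,V)$ and $2g(\tau(V),W)=g(D_VT,W)+g(D_WT,V)$. They take values in $\mathcal H$, $J(T)=\tau(T)=0$, and $2g(J(V),W)=-g([V,W],T)$ for horizontal $V,W$. For a nonzero horizontal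 $V$, the basis $\{V,J(V),T\}$ is positively oriented. Connection: the sub-Riemannian connection $\nabla$ is the unique metric connection (for $g$) whose torsion tensor $\operatorname{Tor}(V,W)=\nabla_VW-\nabla_WV-[V,W]$ is given by $\operatorname{Tor}(V,W)=g(V,T)\,\tau(W)-g(W,T)\,\tau(V)+2g(J(V),W)\,T$. One has $\nabla T\equiv0$. $\nabla$-geodesics: a curve $\gamma$ defined on an interval $I$ is a $\nabla$-geodesic of curvature $h:I\to\mathbb R$ if $\nabla_{\dot\gamma}\dot\gamma+h\,J(\dot\gamma)=0$, with $J$ the operator just defined. Prescribed mean curvature: for bounded open $B$, $P(E,B)=\sup\{\int_{E\cap B}\operatorname{div}U\,dM : U \text{ horizontal},\ \operatorname{supp}U\subset B,\ \|U\|_\infty\le 1\}$. A set $E\subset\Omega$ of locally finite perimeter (that is, $P(E,B)<\infty$ for every bounded open $B$) has prescribed mean curvature $f$ on $\Omega$ if, for every bounded open $B\subset\Omega$, $E$ is a critical point of $P(E,B)-\int_{E\cap B}f\,dM$; the admissible variations are the flows induced by vector fields with compact support in $B$. Regular points and characteristic curves: on $\mathbb R^3$ with coordinates $(x,y,t)$ put $\omega_0=dt-y\,dx$. A Darboux chart at $p$ is a diffeomorphism $\phi_p$ from a neighbourhood of $p$ onto an open subset of $\mathbb R^3$ with $\phi_p^*\omega_0=\omega$. A point $p\in\Sigma=\partial E$ is regular if, in a Darboux chart with $\phi_p(p)=0$ (after, if necessary, a Euclidean rotation around the $t$-axis), a neighbourhood of $p$ in $\Sigma$ is the graph $\{(x,u(x,t),t):(x,t)\in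 D\}$ of a Euclidean Lipschitz function $u$ on a domain $D$ of the plane $\{y=0\}$; otherwise $p$ is singular, and $\Sigma_0$ is the set of singular points. Characteristic curves are the horizontal curves contained in $\Sigma\setminus\Sigma_0$; in a graph representation they are the lifts of curves $(x(s),t(s))$ in $D$ with $t'=u(x,t)\,x'$. They are of class $C^2$. $N$ is the Riemannian unit normal to $\Sigma$ (defined a.e.), $N_h$ its orthogonal projection onto $\mathcal H$, and $\nu_h=N_h/|N_h|$ the horizontal unit normal, which is well defined on $\Sigma\setminus\Sigma_0$. $Z$ is the unit tangent vector to the characteristic curves, $\dot\gamma=Z$, oriented so that $\nu_h$ is a negative multiple of $J(Z)$. The mean curvature at $p\in\Sigma\setminus\Sigma_0$ is $H(p)=g(\nabla_ZZ,\nu_h)(p)$.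
   Formalization: The displayed equation fails when |J(γ')| ≠ 1 and H ≠ 0, as J is not normalized. Proved instead: characteristic curves are ∇-geodesics of curvature H/|J(γ')| in general, and of curvature H when J is isometric on the horizontal distribution. *)

theory Defs
  imports "HOL-Analysis.Analysis"
begin

section \<open>Smooth 3-manifolds\<close>

text \<open>
  A 3-manifold is a Hausdorff second countable type \<open>'m\<close> with a smooth atlas.  A chart is a pair of
  its domain and its coordinate map; the map is irrelevant outside the domain.  A tangent vector at
  \<open>p\<close> is the derivation \<open>f \<mapsto> df(v)\<close> on functions that are smooth near \<open>p\<close>; to make it a total
  function, it has the value 0 on all other functions.  The linear operations on tangent vectors
  are therefore pointwise, and the zero vector is the zero function.
\<close>

type_synonym 'm chart = "'m set \<times> ('m \<Rightarrow> real ^ 3)"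
type_synonym 'm tvec = "('m \<Rightarrow> real) \<Rightarrow> real"
type_synonym 'm vfield = "'m \<Rightarrow> 'm tvec"

text \<open>Continuous differentiability of order \<open>k\<close> on an open set, by recursion on directional
  derivatives.\<close>

fun Ck_on :: "nat \<Rightarrow> 'a::real_normed_vector set \<Rightarrow> ('a \<Rightarrow> 'b::real_normed_vector) \<Rightarrow> bool" where
  "Ck_on 0 S f = continuous_on S f"
| "Ck_on (Suc k) S f =
     (\<exists>f'. (\<forall>x\<in>S. (f has_derivative f' x) (at x)) \<and> (\<forall>v. Ck_on k S (\<lambda>x. f' x v)))"

definition Cinf_on :: "'a::real_normed_vector set \<Rightarrow> ('a \<Rightarrow> 'b::real_normed_vector) \<Rightarrow> bool" where
  "Cinf_on S f \<longleftrightarrow> (\<forall>k. Ck_on k S f)"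

definition chart_inv :: "'m chart \<Rightarrow> real ^ 3 \<Rightarrow> 'm" where
  "chart_inv c = inv_into (fst c) (snd c)"

definition coord :: "'m chart \<Rightarrow> 3 \<Rightarrow> 'm \<Rightarrow> real" where
  "coord c i = (\<lambda>q. snd c q $ i)"

definition topological_chart :: "'m::topological_space chart \<Rightarrow> bool" where
  "topological_chart c \<longleftrightarrow>
     open (fst c) \<and> open (snd c ` fst c) \<and> homeomorphism (fst c) (snd c ` fst c) (snd c) (chart_inv c)"

definition compatible :: "'m::topological_space chart \<Rightarrow> 'm chart \<Rightarrow> bool" where
  "compatible c d \<longleftrightarrow>
     Cinf_on (snd c ` (fst c \<inter> fst d)) (snd d \<circ> chart_inv c) \<and>
     Cinf_on (snd d ` (fst c \<inter> fst d)) (snd c \<circ> chart_inv d)"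

definition smooth_atlas :: "'m::topological_space chart set \<Rightarrow> bool" where
  "smooth_atlas A \<longleftrightarrow>
     (\<forall>c\<in>A. topological_chart c) \<and> (\<Union>c\<in>A. fst c) = UNIV \<and> (\<forall>c\<in>A. \<forall>d\<in>A. compatible c d)"

text \<open>The charts of the maximal atlas, that is, the diffeomorphisms from open subsets of the manifold
  onto open subsets of \<open>\<real>\<^sup>3\<close>.\<close>

definition smooth_chart :: "'m::topological_space chart set \<Rightarrow> 'm chart \<Rightarrow> bool" where
  "smooth_chart A c \<longleftrightarrow> topological_chart c \<and> (\<forall>d\<in>A. compatible c d)"

definition smooth_fun :: "'m::topological_space chart set \<Rightarrow> 'm set \<Rightarrow> ('m \<Rightarrow> real) \<Rightarrow> bool" where
  "smooth_fun A W f \<longleftrightarrow> (\<forall>c\<in>A. Cinf_on (snd c ` (W \<inter> fst c)) (f \<circ> chart_inv c))"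

definition smooth_near :: "'m::topological_space chart set \<Rightarrow> 'm \<Rightarrow> ('m \<Rightarrow> real) \<Rightarrow> bool" where
  "smooth_near A p f \<longleftrightarrow> (\<exists>W. open W \<and> p \<in> W \<and> smooth_fun A W f)"

text \<open>The tangent vector at \<open>p\<close> with components \<open>\<xi>\<close> in the chart \<open>c\<close>.\<close>

definition coord_vec :: "'m::topological_space chart set \<Rightarrow> 'm chart \<Rightarrow> 'm \<Rightarrow> real ^ 3 \<Rightarrow> 'm tvec" where
  "coord_vec A c p \<xi> =
     (\<lambda>f. if smooth_near A p f then frechet_derivative (f \<circ> chart_inv c) (at (snd c p)) \<xi> else 0)"

definition coord_field :: "'m::topological_space chart set \<Rightarrow> 'm chart \<Rightarrow> 3 \<Rightarrow> 'm vfield" where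
  "coord_field A c i = (\<lambda>q. coord_vec A c q (axis i 1))"

definition tangent :: "'m::topological_space chart set \<Rightarrow> 'm \<Rightarrow> 'm tvec set" where
  "tangent A p = {v. \<exists>c\<in>A. p \<in> fst c \<and> (\<exists>\<xi>. v = coord_vec A c p \<xi>)}"

definition smooth_vf :: "'m::topological_space chart set \<Rightarrow> 'm set \<Rightarrow> 'm vfield \<Rightarrow> bool" where
  "smooth_vf A U X \<longleftrightarrow>
     (\<forall>p\<in>U. X p \<in> tangent A p) \<and>
     (\<forall>W f. open W \<longrightarrow> W \<subseteq> U \<longrightarrow> smooth_fun A W f \<longrightarrow> smooth_fun A W (\<lambda>p. X p f))"

definition lcomb :: "real \<Rightarrow> 'm tvec \<Rightarrow> real \<Rightarrow> 'm tvec \<Rightarrow> 'm tvec" where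
  "lcomb a u b v = (\<lambda>f. a * u f + b * v f)"

definition lie :: "'m::topological_space chart set \<Rightarrow> 'm vfield \<Rightarrow> 'm vfield \<Rightarrow> 'm vfield" where
  "lie A X Y p =
     (\<lambda>f. if smooth_near A p f then X p (\<lambda>q. Y q f) - Y p (\<lambda>q. X q f) else 0)"

definition support :: "'m::topological_space vfield \<Rightarrow> 'm set" where
  "support X = closure {p. X p \<noteq> (\<lambda>f. 0)}"

definition has_velocity ::
  "'m::topological_space chart set \<Rightarrow> (real \<Rightarrow> 'm) \<Rightarrow> real set \<Rightarrow> real \<Rightarrow> 'm tvec \<Rightarrow> bool" where
  "has_velocity A \<alpha> I s v \<longleftrightarrow>
     v \<in> tangent A (\<alpha> s) \<and>
     (\<forall>f. smooth_near A (\<alpha> s) f \<longrightarrow> ((f \<circ> \<alpha>) has_real_derivative v f) (at s within I))"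

definition velocity ::
  "'m::topological_space chart set \<Rightarrow> (real \<Rightarrow> 'm) \<Rightarrow> real set \<Rightarrow> real \<Rightarrow> 'm tvec" where
  "velocity A \<gamma> I s =
     (\<lambda>f. if smooth_near A (\<gamma> s) f then vector_derivative (f \<circ> \<gamma>) (at s within I) else 0)"

definition C2_curve :: "'m::topological_space chart set \<Rightarrow> (real \<Rightarrow> 'm) \<Rightarrow> real set \<Rightarrow> bool" where
  "C2_curve A \<gamma> I \<longleftrightarrow>
     continuous_on I \<gamma> \<and>
     (\<forall>c\<in>A. \<exists>d1 d2.
        (\<forall>s\<in>I. \<gamma> s \<in> fst c \<longrightarrow>
           ((snd c \<circ> \<gamma>) has_vector_derivative d1 s) (at s within I) \<and>
           (d1 has_vector_derivative d2 s) (at s within I)) \<and>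
        continuous_on {s\<in>I. \<gamma> s \<in> fst c} d2)"

text \<open>\<open>\<Phi> s\<close> is the flow at time \<open>s\<close> of a (complete) vector field.\<close>

definition is_flow ::
  "'m::topological_space chart set \<Rightarrow> 'm vfield \<Rightarrow> (real \<Rightarrow> 'm \<Rightarrow> 'm) \<Rightarrow> bool" where
  "is_flow A X \<Phi> \<longleftrightarrow>
     (\<forall>p. \<Phi> 0 p = p \<and> continuous_on UNIV (\<lambda>s. \<Phi> s p) \<and>
          (\<forall>s. has_velocity A (\<lambda>r. \<Phi> r p) UNIV s (X (\<Phi> s p))))"


section \<open>Contact sub-Riemannian manifolds\<close>

text \<open>
  The data are the atlas, the contact form \<open>\<omega>\<close> and the metric on \<open>ker \<omega>\<close>.  The remaining components
  are determined by these; the record only gives them names, and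
  \<open>contact_sub_riemannian\<close> below states the conditions that characterize them.  A connection sends
  \<open>p\<close>, \<open>v \<in> T\<^sub>pM\<close> and a vector field \<open>Y\<close> defined near \<open>p\<close> to \<open>\<nabla>\<^sub>vY \<in> T\<^sub>pM\<close>.
\<close>

record 'm csr =
  atlas :: "'m chart set"
  form :: "'m \<Rightarrow> 'm tvec \<Rightarrow> real"
  hmetric :: "'m \<Rightarrow> 'm tvec \<Rightarrow> 'm tvec \<Rightarrow> real"
  reeb :: "'m vfield"
  vol :: "'m measure"
  levi_civita :: "'m \<Rightarrow> 'm tvec \<Rightarrow> 'm vfield \<Rightarrow> 'm tvec"
  Jop :: "'m \<Rightarrow> 'm tvec \<Rightarrow> 'm tvec"
  tauop :: "'m \<Rightarrow> 'm tvec \<Rightarrow> 'm tvec"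
  srconn :: "'m \<Rightarrow> 'm tvec \<Rightarrow> 'm vfield \<Rightarrow> 'm tvec"

abbreviation tan_sp :: "('m::topological_space) csr \<Rightarrow> 'm \<Rightarrow> 'm tvec set" where
  "tan_sp M p \<equiv> tangent (atlas M) p"

definition horiz :: "('m::topological_space) csr \<Rightarrow> 'm \<Rightarrow> 'm tvec set" where
  "horiz M p = {v \<in> tan_sp M p. form M p v = 0}"

definition one_form :: "('m::topological_space) csr \<Rightarrow> bool" where
  "one_form M \<longleftrightarrow>
     (\<forall>p. \<forall>u\<in>tan_sp M p. \<forall>v\<in>tan_sp M p. \<forall>a b.
        form M p (lcomb a u b v) = a * form M p u + b * form M p v) \<and>
     (\<forall>U X. open U \<longrightarrow> smooth_vf (atlas M) U X \<longrightarrow> smooth_fun (atlas M) U (\<lambda>p. form M p (X p)))"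

text \<open>\<open>d\<omega>(v,w) = X(\<omega>(Y)) - Y(\<omega>(X)) - \<omega>([X,Y])\<close> for any local extensions \<open>X\<close>, \<open>Y\<close> of \<open>v\<close>, \<open>w\<close>.\<close>

definition dform :: "('m::topological_space) csr \<Rightarrow> 'm \<Rightarrow> 'm tvec \<Rightarrow> 'm tvec \<Rightarrow> real" where
  "dform M p v w =
     (THE r. \<forall>U X Y. open U \<and> p \<in> U \<and> smooth_vf (atlas M) U X \<and> smooth_vf (atlas M) U Y \<and>
        X p = v \<and> Y p = w \<longrightarrow>
        r = X p (\<lambda>q. form M q (Y q)) - Y p (\<lambda>q. form M q (X q)) - form M p (lie (atlas M) X Y p))"

definition contact_form :: "('m::topological_space) csr \<Rightarrow> bool" where
  "contact_form M \<longleftrightarrow>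
     one_form M \<and>
     (\<forall>p. (\<exists>v\<in>tan_sp M p. form M p v \<noteq> 0) \<and>
          (\<forall>v\<in>horiz M p. v \<noteq> (\<lambda>f. 0) \<longrightarrow> (\<exists>w\<in>horiz M p. dform M p v w \<noteq> 0)))"

definition sub_riemannian_metric :: "('m::topological_space) csr \<Rightarrow> bool" where
  "sub_riemannian_metric M \<longleftrightarrow>
     (\<forall>p. \<forall>u\<in>horiz M p. \<forall>v\<in>horiz M p.
        hmetric M p u v = hmetric M p v u \<and>
        (\<forall>w\<in>horiz M p. \<forall>a b.
           hmetric M p (lcomb a u b v) w = a * hmetric M p u w + b * hmetric M p v w)) \<and>
     (\<forall>p. \<forall>v\<in>horiz M p. v \<noteq> (\<lambda>f. 0) \<longrightarrow> hmetric M p v v > 0) \<and>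
     (\<forall>U X Y. open U \<longrightarrow> smooth_vf (atlas M) U X \<longrightarrow> smooth_vf (atlas M) U Y \<longrightarrow>
        (\<forall>p\<in>U. X p \<in> horiz M p \<and> Y p \<in> horiz M p) \<longrightarrow>
        smooth_fun (atlas M) U (\<lambda>p. hmetric M p (X p) (Y p)))"

text \<open>The second condition is \<open>(L\<^sub>T\<omega>)(X) = T(\<omega>(X)) - \<omega>([T,X]) = 0\<close>.\<close>

definition reeb_field :: "('m::topological_space) csr \<Rightarrow> bool" where
  "reeb_field M \<longleftrightarrow>
     smooth_vf (atlas M) UNIV (reeb M) \<and>
     (\<forall>p. form M p (reeb M p) = 1) \<and>
     (\<forall>U X. open U \<longrightarrow> smooth_vf (atlas M) U X \<longrightarrow>
        (\<forall>p\<in>U. reeb M p (\<lambda>q. form M q (X q)) - form M p (lie (atlas M) (reeb M) X p) = 0))"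

definition hproj :: "('m::topological_space) csr \<Rightarrow> 'm \<Rightarrow> 'm tvec \<Rightarrow> 'm tvec" where
  "hproj M p v = lcomb 1 v (- form M p v) (reeb M p)"

text \<open>The Riemannian extension \<open>g\<close>: \<open>T\<close> is a unit vector orthogonal to \<open>ker \<omega>\<close>.\<close>

definition gmet :: "('m::topological_space) csr \<Rightarrow> 'm \<Rightarrow> 'm tvec \<Rightarrow> 'm tvec \<Rightarrow> real" where
  "gmet M p v w = hmetric M p (hproj M p v) (hproj M p w) + form M p v * form M p w"

definition gnorm :: "('m::topological_space) csr \<Rightarrow> 'm \<Rightarrow> 'm tvec \<Rightarrow> real" where
  "gnorm M p v = sqrt (gmet M p v v)"

definition gram :: "('m::topological_space) csr \<Rightarrow> 'm chart \<Rightarrow> 'm \<Rightarrow> real ^ 3 ^ 3" where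
  "gram M c q = (\<chi> i j. gmet M q (coord_field (atlas M) c i q) (coord_field (atlas M) c j q))"

definition riemannian_volume :: "('m::topological_space) csr \<Rightarrow> bool" where
  "riemannian_volume M \<longleftrightarrow>
     sets (vol M) = sets borel \<and>
     (\<forall>c\<in>atlas M. \<forall>B\<in>sets borel. B \<subseteq> fst c \<longrightarrow>
        emeasure (vol M) B =
          (\<integral>\<^sup>+ x \<in> snd c ` B. ennreal (sqrt (det (gram M c (chart_inv c x)))) \<partial>lborel))"

definition metric_connection ::
  "('m::topological_space) csr \<Rightarrow> ('m \<Rightarrow> 'm tvec \<Rightarrow> 'm vfield \<Rightarrow> 'm tvec) \<Rightarrow> bool" where
  "metric_connection M D \<longleftrightarrow>
     (\<forall>U p Y Z. open U \<longrightarrow> p \<in> U \<longrightarrow> smooth_vf (atlas M) U Y \<longrightarrow> smooth_vf (atlas M) U Z \<longrightarrow>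
        (\<forall>u\<in>tan_sp M p. \<forall>v\<in>tan_sp M p. \<forall>a b.
           D p (lcomb a u b v) Y = lcomb a (D p u Y) b (D p v Y)) \<and>
        (\<forall>v\<in>tan_sp M p.
           D p v Y \<in> tan_sp M p \<and>
           D p v (\<lambda>q. lcomb 1 (Y q) 1 (Z q)) = lcomb 1 (D p v Y) 1 (D p v Z) \<and>
           (\<forall>f. smooth_fun (atlas M) U f \<longrightarrow>
              D p v (\<lambda>q g. f q * Y q g) = lcomb (v f) (Y p) (f p) (D p v Y)) \<and>
           (\<forall>Y'. (\<forall>q\<in>U. Y' q = Y q) \<longrightarrow> D p v Y' = D p v Y) \<and>
           v (\<lambda>q. gmet M q (Y q) (Z q)) = gmet M p (D p v Y) (Z p) + gmet M p (Y p) (D p v Z))) \<and>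
     (\<forall>U X Y. open U \<longrightarrow> smooth_vf (atlas M) U X \<longrightarrow> smooth_vf (atlas M) U Y \<longrightarrow>
        smooth_vf (atlas M) U (\<lambda>p. D p (X p) Y))"

definition torsion ::
  "('m::topological_space) csr \<Rightarrow> ('m \<Rightarrow> 'm tvec \<Rightarrow> 'm vfield \<Rightarrow> 'm tvec) \<Rightarrow>
     'm vfield \<Rightarrow> 'm vfield \<Rightarrow> 'm vfield" where
  "torsion M D X Y p = (\<lambda>f. D p (X p) Y f - D p (Y p) X f - lie (atlas M) X Y p f)"

definition levi_civita_connection :: "('m::topological_space) csr \<Rightarrow> bool" where
  "levi_civita_connection M \<longleftrightarrow>
     metric_connection M (levi_civita M) \<and>
     (\<forall>U X Y. open U \<longrightarrow> smooth_vf (atlas M) U X \<longrightarrow> smooth_vf (atlas M) U Y \<longrightarrow>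
        (\<forall>p\<in>U. torsion M (levi_civita M) X Y p = (\<lambda>f. 0)))"

definition J_tau_operators :: "('m::topological_space) csr \<Rightarrow> bool" where
  "J_tau_operators M \<longleftrightarrow>
     (\<forall>p. \<forall>v\<in>tan_sp M p.
        Jop M p v \<in> tan_sp M p \<and> tauop M p v \<in> tan_sp M p \<and>
        (\<forall>w\<in>tan_sp M p.
           2 * gmet M p (Jop M p v) w =
             gmet M p (levi_civita M p v (reeb M)) w - gmet M p (levi_civita M p w (reeb M)) v \<and>
           2 * gmet M p (tauop M p v) w =
             gmet M p (levi_civita M p v (reeb M)) w + gmet M p (levi_civita M p w (reeb M)) v))"

definition sub_riemannian_connection :: "('m::topological_space) csr \<Rightarrow> bool" where
  "sub_riemannian_connection M \<longleftrightarrow>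
     metric_connection M (srconn M) \<and>
     (\<forall>U X Y. open U \<longrightarrow> smooth_vf (atlas M) U X \<longrightarrow> smooth_vf (atlas M) U Y \<longrightarrow>
        (\<forall>p\<in>U. torsion M (srconn M) X Y p =
           (\<lambda>f. gmet M p (X p) (reeb M p) * tauop M p (Y p) f
              - gmet M p (Y p) (reeb M p) * tauop M p (X p) f
              + 2 * gmet M p (Jop M p (X p)) (Y p) * reeb M p f)))"

definition contact_sub_riemannian ::
  "('m::{t2_space, second_countable_topology}) csr \<Rightarrow> bool" where
  "contact_sub_riemannian M \<longleftrightarrow>
     smooth_atlas (atlas M) \<and> contact_form M \<and> sub_riemannian_metric M \<and> reeb_field M \<and>
     riemannian_volume M \<and> levi_civita_connection M \<and> J_tau_operators M \<and>
     sub_riemannian_connection M"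

text \<open>
  The normalization of the contact form relative to the metric under which \<open>J\<close> is the rotation by
  a right angle in \<open>ker \<omega>\<close>; since \<open>2 g(J(V),W) = d\<omega>(V,W)\<close>, it says that \<open>\<bar>d\<omega>(e\<^sub>1,e\<^sub>2)\<bar> = 2\<close> for
  orthonormal horizontal \<open>e\<^sub>1\<close>, \<open>e\<^sub>2\<close>.  It is not part of \<open>contact_sub_riemannian\<close>.
\<close>

definition J_isometric :: "('m::topological_space) csr \<Rightarrow> bool" where
  "J_isometric M \<longleftrightarrow> (\<forall>p. \<forall>v\<in>horiz M p. gnorm M p (Jop M p v) = gnorm M p v)"


section \<open>Curves\<close>

definition chart_at :: "('m::topological_space) csr \<Rightarrow> 'm \<Rightarrow> 'm chart" where
  "chart_at M p = (SOME c. c \<in> atlas M \<and> p \<in> fst c)"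

text \<open>The covariant derivative along \<open>\<gamma>\<close> of a field \<open>W\<close> along \<open>\<gamma>\<close> has the usual expression
  \<open>\<Sum>\<^sub>i W\<^sub>i' \<partial>\<^sub>i + W\<^sub>i \<nabla>\<^bsub>\<gamma>'\<^esub> \<partial>\<^sub>i\<close> in a chart, where \<open>W\<^sub>i = W(x\<^sub>i)\<close>; it does not depend on the chart.\<close>

definition cov_along ::
  "('m::topological_space) csr \<Rightarrow> (real \<Rightarrow> 'm) \<Rightarrow> real set \<Rightarrow> (real \<Rightarrow> 'm tvec) \<Rightarrow> real \<Rightarrow> 'm tvec" where
  "cov_along M \<gamma> I W s =
     (let c = chart_at M (\<gamma> s) in
      (\<lambda>f. \<Sum>i\<in>UNIV.
        vector_derivative (\<lambda>r. W r (coord c i)) (at s within I) * coord_field (atlas M) c i (\<gamma> s) f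
        + W s (coord c i)
          * srconn M (\<gamma> s) (velocity (atlas M) \<gamma> I s) (coord_field (atlas M) c i) f))"

definition acceleration ::
  "('m::topological_space) csr \<Rightarrow> (real \<Rightarrow> 'm) \<Rightarrow> real set \<Rightarrow> real \<Rightarrow> 'm tvec" where
  "acceleration M \<gamma> I = cov_along M \<gamma> I (velocity (atlas M) \<gamma> I)"

definition nabla_geodesic ::
  "('m::topological_space) csr \<Rightarrow> (real \<Rightarrow> 'm) \<Rightarrow> real set \<Rightarrow> (real \<Rightarrow> real) \<Rightarrow> bool" where
  "nabla_geodesic M \<gamma> I h \<longleftrightarrow>
     (\<forall>s\<in>I. lcomb 1 (acceleration M \<gamma> I s) (h s) (Jop M (\<gamma> s) (velocity (atlas M) \<gamma> I s)) = (\<lambda>f. 0))"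

text \<open>Bounded for the Carnot-Caratheodory distance: for some \<open>p\<close> and \<open>R\<close>, every point of \<open>B\<close> is
  joined to \<open>p\<close> in unit time by a horizontal curve of speed at most \<open>R\<close>.\<close>

definition cc_bounded :: "('m::topological_space) csr \<Rightarrow> 'm set \<Rightarrow> bool" where
  "cc_bounded M B \<longleftrightarrow>
     (\<exists>p R. \<forall>q\<in>B. \<exists>\<alpha> F. continuous_on {0..1::real} \<alpha> \<and> \<alpha> 0 = p \<and> \<alpha> 1 = q \<and> finite F \<and>
        (\<forall>s\<in>{0..1} - F. \<exists>v\<in>horiz M (\<alpha> s).
           has_velocity (atlas M) \<alpha> {0..1} s v \<and> gnorm M (\<alpha> s) v \<le> R))"


section \<open>Perimeter and prescribed mean curvature\<close>

text \<open>The divergence for \<open>dM\<close> is the trace of \<open>v \<mapsto> D\<^sub>vU\<close>, computed here in a chart.\<close>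

definition divergence :: "('m::topological_space) csr \<Rightarrow> 'm vfield \<Rightarrow> 'm \<Rightarrow> real" where
  "divergence M U p =
     (let c = chart_at M p in
      (\<Sum>i\<in>UNIV. levi_civita M p (coord_field (atlas M) c i p) U (coord c i)))"

definition perimeter :: "('m::topological_space) csr \<Rightarrow> 'm set \<Rightarrow> 'm set \<Rightarrow> ereal" where
  "perimeter M E B =
     (SUP U \<in> {U. smooth_vf (atlas M) UNIV U \<and> (\<forall>p. U p \<in> horiz M p) \<and>
                  compact (support U) \<and> support U \<subseteq> B \<and> (\<forall>p. gnorm M p (U p) \<le> 1)}.
        ereal (LINT p : E \<inter> B | completion (vol M). divergence M U p))"

definition locally_finite_perimeter :: "('m::topological_space) csr \<Rightarrow> 'm set \<Rightarrow> bool" where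
  "locally_finite_perimeter M E \<longleftrightarrow>
     E \<in> sets (completion (vol M)) \<and> (\<forall>B. open B \<longrightarrow> cc_bounded M B \<longrightarrow> perimeter M E B < \<infinity>)"

text \<open>The functional \<open>P(E,B) - \<integral>\<^bsub>E\<inter>B\<^esub> f dM\<close> only makes sense if \<open>f\<close> is integrable on \<open>B\<close>, which can
  fail for a continuous \<open>f\<close> when the closure of \<open>B\<close> is not a compact subset of \<open>\<Omega>\<close>.\<close>

definition prescribed_mean_curvature ::
  "('m::topological_space) csr \<Rightarrow> 'm set \<Rightarrow> 'm set \<Rightarrow> ('m \<Rightarrow> real) \<Rightarrow> bool" where
  "prescribed_mean_curvature M \<Omega> E f \<longleftrightarrow>
     E \<subseteq> \<Omega> \<and> locally_finite_perimeter M E \<and>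
     (\<forall>B. open B \<longrightarrow> cc_bounded M B \<longrightarrow> B \<subseteq> \<Omega> \<longrightarrow> set_integrable (completion (vol M)) B f \<longrightarrow>
        (\<forall>X \<Phi>. smooth_vf (atlas M) UNIV X \<longrightarrow> compact (support X) \<longrightarrow> support X \<subseteq> B \<longrightarrow>
           is_flow (atlas M) X \<Phi> \<longrightarrow>
           ((\<lambda>s. real_of_ereal (perimeter M (\<Phi> s ` E) B)
                 - (LINT p : \<Phi> s ` E \<inter> B | completion (vol M). f p))
              has_real_derivative 0) (at 0)))"


section \<open>Lipschitz boundaries, regular points and normals\<close>

definition bdry :: "'m::topological_space set \<Rightarrow> 'm set \<Rightarrow> 'm set" where
  "bdry \<Omega> E = \<Omega> \<inter> frontier E"

text \<open>Near \<open>p\<close>, in the chart \<open>c\<close>, the set \<open>E\<close> is the region below the graph of \<open>\<psi>\<close>, up to points of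
  the graph.\<close>

definition lipschitz_graph_at ::
  "('m::topological_space) csr \<Rightarrow> 'm set \<Rightarrow> 'm set \<Rightarrow> 'm \<Rightarrow> 'm chart \<Rightarrow> (real \<times> real \<Rightarrow> real) \<Rightarrow> bool" where
  "lipschitz_graph_at M \<Omega> E p c \<psi> \<longleftrightarrow>
     smooth_chart (atlas M) c \<and> (\<exists>L. L-lipschitz_on UNIV \<psi>) \<and>
     (\<exists>W. open W \<and> p \<in> W \<and> W \<subseteq> fst c \<inter> \<Omega> \<and>
        (\<forall>q\<in>W. (coord c 3 q < \<psi> (coord c 1 q, coord c 2 q) \<longrightarrow> q \<in> E) \<and>
               (coord c 3 q > \<psi> (coord c 1 q, coord c 2 q) \<longrightarrow> q \<notin> E)))"

definition lipschitz_boundary ::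
  "('m::topological_space) csr \<Rightarrow> 'm set \<Rightarrow> 'm set \<Rightarrow> bool" where
  "lipschitz_boundary M \<Omega> E \<longleftrightarrow> (\<forall>p\<in>bdry \<Omega> E. \<exists>c \<psi>. lipschitz_graph_at M \<Omega> E p c \<psi>)"

text \<open>With coordinates \<open>(x,y,t)\<close>, the condition is \<open>\<omega> = dt - y dx\<close>.\<close>

definition darboux_chart :: "('m::topological_space) csr \<Rightarrow> 'm chart \<Rightarrow> bool" where
  "darboux_chart M c \<longleftrightarrow>
     smooth_chart (atlas M) c \<and>
     (\<forall>q\<in>fst c. \<forall>v\<in>tan_sp M q. form M q v = v (coord c 3) - coord c 2 q * v (coord c 1))"

definition rot_t :: "real \<Rightarrow> real ^ 3 \<Rightarrow> real ^ 3" where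
  "rot_t \<theta> z = vector [cos \<theta> * z $ 1 - sin \<theta> * z $ 2, sin \<theta> * z $ 1 + cos \<theta> * z $ 2, z $ 3]"

definition regular_point ::
  "('m::topological_space) csr \<Rightarrow> 'm set \<Rightarrow> 'm set \<Rightarrow> 'm \<Rightarrow> bool" where
  "regular_point M \<Omega> E p \<longleftrightarrow>
     p \<in> bdry \<Omega> E \<and>
     (\<exists>c \<theta> W D u L. darboux_chart M c \<and> p \<in> fst c \<and> snd c p = 0 \<and>
        open W \<and> p \<in> W \<and> W \<subseteq> fst c \<and>
        open D \<and> connected D \<and> L-lipschitz_on D u \<and>
        (\<lambda>q. rot_t \<theta> (snd c q)) ` (bdry \<Omega> E \<inter> W) = {vector [x, u (x, t), t] | x t. (x, t) \<in> D})"

definition singular_set :: "('m::topological_space) csr \<Rightarrow> 'm set \<Rightarrow> 'm set \<Rightarrow> 'm set" where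
  "singular_set M \<Omega> E = {p \<in> bdry \<Omega> E. \<not> regular_point M \<Omega> E p}"

text \<open>At points where the boundary has a tangent plane, that is, where a graph function is
  differentiable.\<close>

definition outer_unit_normal ::
  "('m::topological_space) csr \<Rightarrow> 'm set \<Rightarrow> 'm set \<Rightarrow> 'm \<Rightarrow> 'm tvec \<Rightarrow> bool" where
  "outer_unit_normal M \<Omega> E p n \<longleftrightarrow>
     p \<in> bdry \<Omega> E \<and> n \<in> tan_sp M p \<and> gnorm M p n = 1 \<and>
     (\<exists>c \<psi> L. lipschitz_graph_at M \<Omega> E p c \<psi> \<and>
        (\<psi> has_derivative L) (at (coord c 1 p, coord c 2 p)) \<and>
        (\<forall>\<xi>. \<xi> $ 3 = L (\<xi> $ 1, \<xi> $ 2) \<longrightarrow> gmet M p n (coord_vec (atlas M) c p \<xi>) = 0) \<and>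
        n (coord c 3) > L (n (coord c 1), n (coord c 2)))"

text \<open>\<open>N\<close> is one of the two unit normals, defined almost everywhere.\<close>

definition unit_normal ::
  "('m::topological_space) csr \<Rightarrow> 'm set \<Rightarrow> 'm set \<Rightarrow> 'm vfield \<Rightarrow> bool" where
  "unit_normal M \<Omega> E N \<longleftrightarrow>
     (\<forall>p n. outer_unit_normal M \<Omega> E p n \<longrightarrow> N p = n) \<or>
     (\<forall>p n. outer_unit_normal M \<Omega> E p n \<longrightarrow> N p = (\<lambda>f. - n f))"

text \<open>\<open>\<nu>\<close> is \<open>N\<^sub>h/\<bar>N\<^sub>h\<bar>\<close> where \<open>N\<close> is defined; at every other regular point it is the limit of
  these values (in the tangent bundle).\<close>

definition horizontal_unit_normal ::
  "('m::topological_space) csr \<Rightarrow> 'm set \<Rightarrow> 'm set \<Rightarrow> 'm vfield \<Rightarrow> 'm vfield \<Rightarrow> bool" where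
  "horizontal_unit_normal M \<Omega> E N \<nu> \<longleftrightarrow>
     (\<forall>p \<in> bdry \<Omega> E - singular_set M \<Omega> E.
        \<nu> p \<in> horiz M p \<and> gnorm M p (\<nu> p) = 1 \<and>
        ((\<exists>n. outer_unit_normal M \<Omega> E p n) \<longrightarrow>
           \<nu> p = (\<lambda>f. hproj M p (N p) f / gnorm M p (hproj M p (N p)))) \<and>
        (\<forall>f. smooth_near (atlas M) p f \<longrightarrow>
           ((\<lambda>q. hproj M q (N q) f / gnorm M q (hproj M q (N q))) \<longlongrightarrow> \<nu> p f)
             (at p within {q. \<exists>n. outer_unit_normal M \<Omega> E q n})))"

text \<open>Characteristic curves parametrized so that \<open>\<gamma>' = Z\<close>: unit speed, and \<open>\<nu>\<close> is a negative
  multiple of \<open>J(\<gamma>')\<close>.\<close>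

definition characteristic_curve ::
  "('m::topological_space) csr \<Rightarrow> 'm set \<Rightarrow> 'm set \<Rightarrow> 'm vfield \<Rightarrow> (real \<Rightarrow> 'm) \<Rightarrow> real set \<Rightarrow> bool" where
  "characteristic_curve M \<Omega> E \<nu> \<gamma> I \<longleftrightarrow>
     is_interval I \<and> (\<exists>a\<in>I. \<exists>b\<in>I. a < b) \<and> C2_curve (atlas M) \<gamma> I \<and>
     (\<forall>s\<in>I. \<gamma> s \<in> bdry \<Omega> E - singular_set M \<Omega> E \<and>
        form M (\<gamma> s) (velocity (atlas M) \<gamma> I s) = 0 \<and>
        gnorm M (\<gamma> s) (velocity (atlas M) \<gamma> I s) = 1 \<and>
        (\<exists>k>0. \<nu> (\<gamma> s) = (\<lambda>f. - k * Jop M (\<gamma> s) (velocity (atlas M) \<gamma> I s) f)))"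

text \<open>\<open>H = g(\<nabla>\<^sub>ZZ, \<nu>)\<close>, where \<open>\<nabla>\<^sub>ZZ\<close> is computed along the characteristic curve through the point.\<close>

definition mean_curvature ::
  "('m::topological_space) csr \<Rightarrow> 'm set \<Rightarrow> 'm set \<Rightarrow> 'm vfield \<Rightarrow> ('m \<Rightarrow> real) \<Rightarrow> bool" where
  "mean_curvature M \<Omega> E \<nu> H \<longleftrightarrow>
     (\<forall>\<gamma> I. characteristic_curve M \<Omega> E \<nu> \<gamma> I \<longrightarrow>
        (\<forall>s\<in>I. H (\<gamma> s) = gmet M (\<gamma> s) (acceleration M \<gamma> I s) (\<nu> (\<gamma> s))))"

end

theory Submission
  imports Defs
begin

text \<open>
  Let \<open>\<gamma>\<close> be a characteristic curve, \<open>a = \<nabla>\<^bsub>\<gamma>'\<^esub>\<gamma>'\<close> and \<open>T\<close> the Reeb field.  The tangent space along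
  \<open>\<gamma>\<close> is three-dimensional, and \<open>T\<close>, \<open>\<gamma>'\<close>, \<open>\<nu>\<close> is an orthonormal basis of it: \<open>\<gamma>'\<close> and \<open>\<nu>\<close> are
  horizontal unit vectors, and \<open>\<nu>\<close> is a multiple of \<open>J(\<gamma>')\<close>, which is orthogonal to \<open>\<gamma>'\<close> because \<open>J\<close>
  is antisymmetric.  Two components of \<open>a\<close> vanish (\<open>acceleration_orthogonal\<close>).  Since \<open>\<nabla>\<close> is metric,
  differentiating \<open>g(\<gamma>', \<gamma>') = 1\<close> gives \<open>g(a, \<gamma>') = 0\<close>, and differentiating \<open>g(\<gamma>', T) = 0\<close> gives
  \<open>g(a, T) = - g(\<gamma>', \<nabla>\<^bsub>\<gamma>'\<^esub>T) = 0\<close>, because \<open>T\<close> is parallel.  Therefore \<open>a = g(a, \<nu>) \<nu> = H \<nu>\<close>, and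
  \<open>\<nu>\<close> is the unit vector \<open>- J(\<gamma>') / \<bar>J(\<gamma>')\<bar>\<close>, so \<open>a + (H / \<bar>J(\<gamma>')\<bar>) J(\<gamma>') = 0\<close>.  If \<open>J\<close> is
  isometric on horizontal vectors, the denominator is 1.

  The one fact of sub-Riemannian geometry behind this is \<open>\<nabla>T = 0\<close> (\<open>reeb_parallel\<close>).  It is derived
  from the prescribed torsion of \<open>\<nabla>\<close> by comparison with the Levi-Civita connection \<open>D\<close>; the
  Reeb condition enters through \<open>D\<^sub>TT = 0\<close> (\<open>reeb_geodesic\<close>).

  The acceleration is defined by a coordinate expression, so the two differentiations are carried out
  in a chart (\<open>has_derivative_gmet_velocity\<close>, \<open>has_derivative_speed\<close>).  This requires coordinate
  fields to be smooth vector fields, which in turn rests on the chain rule for maps of class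
  \<open>C\<^sup>k\<close> (\<open>Ck_on_compose\<close>).
\<close>

section \<open>Calculus of continuously differentiable maps\<close>

\<comment> \<open>The recursion is only used through the introduction and elimination rules below.\<close>
declare Ck_on.simps(2) [simp del]

lemma Ck_on_SucI:
  "(\<And>x. x \<in> S \<Longrightarrow> (f has_derivative f' x) (at x)) \<Longrightarrow> (\<And>v. Ck_on k S (\<lambda>x. f' x v)) \<Longrightarrow> Ck_on (Suc k) S f"
  unfolding Ck_on.simps(2) by (rule exI[of _ f']) simp

lemma Ck_on_SucE:
  assumes "Ck_on (Suc k) S f"
  obtains f' where "\<And>x. x \<in> S \<Longrightarrow> (f has_derivative f' x) (at x)" "\<And>v. Ck_on k S (\<lambda>x. f' x v)"
  using assms unfolding Ck_on.simps(2) by blast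

lemma Ck_on_Suc_D: "Ck_on (Suc k) S f \<Longrightarrow> Ck_on k S f"
proof (induction k arbitrary: f)
  case 0
  then obtain f' where "\<And>x. x \<in> S \<Longrightarrow> (f has_derivative f' x) (at x)"
      "\<And>v. Ck_on 0 S (\<lambda>x. f' x v)"
    by (rule Ck_on_SucE) (rule that)
  then have "continuous_on S f"
    using has_derivative_continuous_on has_derivative_at_withinI by metis
  then show ?case by simp
next
  case (Suc k)
  from Suc.prems obtain f' where "\<And>x. x \<in> S \<Longrightarrow> (f has_derivative f' x) (at x)"
      "\<And>v. Ck_on (Suc k) S (\<lambda>x. f' x v)"
    by (rule Ck_on_SucE) (rule that)
  then show ?case using Suc.IH by (intro Ck_on_SucI[of S f f']) auto
qed

lemma Ck_on_cong:
  assumes "open S" "\<And>x. x \<in> S \<Longrightarrow> f x = g x" "Ck_on k S f"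
  shows "Ck_on k S g"
proof (cases k)
  case 0
  then show ?thesis using assms continuous_on_cong by fastforce
next
  case (Suc m)
  then obtain f' where f': "\<And>x. x \<in> S \<Longrightarrow> (f has_derivative f' x) (at x)"
      "\<And>v. Ck_on m S (\<lambda>x. f' x v)"
    using Ck_on_SucE assms(3) by blast
  have "(g has_derivative f' x) (at x)" if "x \<in> S" for x
    using has_derivative_transform_within_open[OF _ assms(1) that] f' that assms(2) by blast
  then show ?thesis using f'(2) Suc Ck_on_SucI[of S g f'] by simp
qed

lemma Ck_on_subset: "Ck_on k S f \<Longrightarrow> T \<subseteq> S \<Longrightarrow> Ck_on k T f"
proof (induction k arbitrary: f)
  case 0
  then show ?case using continuous_on_subset by auto
next
  case (Suc k)
  from Suc.prems(1) obtain f' where "\<And>x. x \<in> S \<Longrightarrow> (f has_derivative f' x) (at x)"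
      "\<And>v. Ck_on k S (\<lambda>x. f' x v)"
    by (rule Ck_on_SucE) (rule that)
  then show ?case
    using Suc.IH Suc.prems(2) by (intro Ck_on_SucI[of T f f']) auto
qed

lemma Ck_on_const: "Ck_on k S (\<lambda>x. a)"
proof (induction k arbitrary: a)
  case (Suc k)
  show ?case by (rule Ck_on_SucI[where f' = "\<lambda>x v. 0"]) (auto intro: Suc)
qed simp

lemma Ck_on_add: "Ck_on k S f \<Longrightarrow> Ck_on k S g \<Longrightarrow> Ck_on k S (\<lambda>x. f x + g x)"
proof (induction k arbitrary: f g)
  case 0
  then show ?case by (auto intro: continuous_on_add)
next
  case (Suc k)
  obtain f' where f': "\<And>x. x \<in> S \<Longrightarrow> (f has_derivative f' x) (at x)" "\<And>v. Ck_on k S (\<lambda>x. f' x v)"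
    using Suc.prems(1) by (rule Ck_on_SucE) (rule that)
  obtain g' where g': "\<And>x. x \<in> S \<Longrightarrow> (g has_derivative g' x) (at x)" "\<And>v. Ck_on k S (\<lambda>x. g' x v)"
    using Suc.prems(2) by (rule Ck_on_SucE) (rule that)
  show ?case
    by (rule Ck_on_SucI[where f' = "\<lambda>x v. f' x v + g' x v"])
      (use f' g' Suc.IH in \<open>auto intro: has_derivative_add\<close>)
qed

lemma Ck_on_sum:
  "finite B \<Longrightarrow> (\<And>i. i \<in> B \<Longrightarrow> Ck_on k S (f i)) \<Longrightarrow> Ck_on k S (\<lambda>x. \<Sum>i\<in>B. f i x)"
  by (induction B rule: finite_induct) (auto intro!: Ck_on_const Ck_on_add)

lemma Ck_on_bounded_linear:
  assumes "bounded_linear L"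
  shows "Ck_on k S f \<Longrightarrow> Ck_on k S (\<lambda>x. L (f x))"
proof (induction k arbitrary: f)
  case 0
  then show ?case
    using assms by (auto intro: bounded_linear.continuous_on)
next
  case (Suc k)
  obtain f' where f': "\<And>x. x \<in> S \<Longrightarrow> (f has_derivative f' x) (at x)" "\<And>v. Ck_on k S (\<lambda>x. f' x v)"
    using Suc.prems by (rule Ck_on_SucE) (rule that)
  show ?case
    by (rule Ck_on_SucI[where f' = "\<lambda>x v. L (f' x v)"])
      (use f' Suc.IH assms in \<open>auto intro: bounded_linear.has_derivative\<close>)
qed

lemma Ck_on_scaleR:
  fixes f :: "'a::real_normed_vector \<Rightarrow> real"
  shows "Ck_on k S f \<Longrightarrow> Ck_on k S g \<Longrightarrow> Ck_on k S (\<lambda>x. f x *\<^sub>R g x)"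
proof (induction k arbitrary: f g)
  case 0
  then show ?case by (auto intro: continuous_on_scaleR)
next
  case (Suc k)
  obtain f' where f': "\<And>x. x \<in> S \<Longrightarrow> (f has_derivative f' x) (at x)" "\<And>v. Ck_on k S (\<lambda>x. f' x v)"
    using Suc.prems(1) by (rule Ck_on_SucE) (rule that)
  obtain g' where g': "\<And>x. x \<in> S \<Longrightarrow> (g has_derivative g' x) (at x)" "\<And>v. Ck_on k S (\<lambda>x. g' x v)"
    using Suc.prems(2) by (rule Ck_on_SucE) (rule that)
  show ?case
  proof (rule Ck_on_SucI[where f' = "\<lambda>x v. f x *\<^sub>R g' x v + f' x v *\<^sub>R g x"])
    show "((\<lambda>x. f x *\<^sub>R g x) has_derivative (\<lambda>v. f x *\<^sub>R g' x v + f' x v *\<^sub>R g x)) (at x)"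
      if "x \<in> S" for x
      using f' g' that by (intro has_derivative_scaleR) auto
    show "Ck_on k S (\<lambda>x. f x *\<^sub>R g' x v + f' x v *\<^sub>R g x)" for v
      by (intro Ck_on_add Suc.IH f' g' Ck_on_Suc_D[OF Suc.prems(1)] Ck_on_Suc_D[OF Suc.prems(2)])
  qed
qed

text \<open>By the chain rule, the derivative of \<open>g \<circ> h\<close> in the direction \<open>v\<close> is a combination of partial
  derivatives of \<open>g\<close> at \<open>h x\<close> with coefficients the components of the derivative of \<open>h\<close>; this
  is what the recursion in \<open>Ck_on\<close> can process.\<close>

lemma Ck_on_compose:
  fixes h :: "'a::real_normed_vector \<Rightarrow> 'b::euclidean_space"
  shows "Ck_on k S h \<Longrightarrow> Ck_on k T g \<Longrightarrow> h ` S \<subseteq> T \<Longrightarrow> Ck_on k S (\<lambda>x. g (h x))"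
proof (induction k arbitrary: g)
  case 0
  then show ?case by (auto intro: continuous_on_compose2)
next
  case (Suc k)
  obtain h' where h': "\<And>x. x \<in> S \<Longrightarrow> (h has_derivative h' x) (at x)" "\<And>v. Ck_on k S (\<lambda>x. h' x v)"
    using Suc.prems(1) by (rule Ck_on_SucE) (rule that)
  obtain g' where g': "\<And>y. y \<in> T \<Longrightarrow> (g has_derivative g' y) (at y)" "\<And>v. Ck_on k T (\<lambda>y. g' y v)"
    using Suc.prems(2) by (rule Ck_on_SucE) (rule that)
  show ?case
  proof (rule Ck_on_SucI[where f' = "\<lambda>x v. \<Sum>b\<in>Basis. (h' x v \<bullet> b) *\<^sub>R g' (h x) b"])
    fix x assume x: "x \<in> S"
    have hx: "h x \<in> T" using x Suc.prems(3) by auto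
    have lin: "linear (g' (h x))"
      using g'(1) hx has_derivative_linear by blast
    have components: "g' (h x) w = (\<Sum>b\<in>Basis. (w \<bullet> b) *\<^sub>R g' (h x) b)" for w
    proof -
      have "g' (h x) w = g' (h x) (\<Sum>b\<in>Basis. (w \<bullet> b) *\<^sub>R b)" by (simp add: euclidean_representation)
      also have "\<dots> = (\<Sum>b\<in>Basis. (w \<bullet> b) *\<^sub>R g' (h x) b)"
        by (simp add: linear_sum[OF lin] linear_cmul[OF lin])
      finally show ?thesis .
    qed
    show "((\<lambda>x. g (h x)) has_derivative (\<lambda>v. \<Sum>b\<in>Basis. (h' x v \<bullet> b) *\<^sub>R g' (h x) b)) (at x)"
      by (rule has_derivative_eq_rhs[OF has_derivative_compose[OF h'(1)[OF x] g'(1)[OF hx]]])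
        (rule ext, rule components)
  next
    fix v
    show "Ck_on k S (\<lambda>x. \<Sum>b\<in>Basis. (h' x v \<bullet> b) *\<^sub>R g' (h x) b)"
    proof (intro Ck_on_sum Ck_on_scaleR)
      show "Ck_on k S (\<lambda>x. h' x v \<bullet> b)" for b
        by (rule Ck_on_bounded_linear[OF bounded_linear_inner_left h'(2)])
      show "Ck_on k S (\<lambda>x. g' (h x) b)" for b
        by (rule Suc.IH[OF Ck_on_Suc_D[OF Suc.prems(1)] g'(2) Suc.prems(3)])
    qed simp
  qed
qed

lemma Cinf_on_differentiable:
  assumes "Cinf_on S f" "x \<in> S"
  shows "f differentiable (at x)"
proof -
  have "Ck_on (Suc 0) S f" using assms(1) by (simp add: Cinf_on_def)
  then show ?thesis using assms(2) by (elim Ck_on_SucE) (auto simp: differentiable_def)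
qed

lemma Cinf_on_frechet_derivative:
  assumes "Cinf_on S f" "open S"
  shows "Cinf_on S (\<lambda>x. frechet_derivative f (at x) v)"
  unfolding Cinf_on_def
proof
  fix k
  have "Ck_on (Suc k) S f" using assms(1) by (simp add: Cinf_on_def)
  then obtain f' where f': "\<And>x. x \<in> S \<Longrightarrow> (f has_derivative f' x) (at x)"
      "\<And>v. Ck_on k S (\<lambda>x. f' x v)"
    by (rule Ck_on_SucE) (rule that)
  show "Ck_on k S (\<lambda>x. frechet_derivative f (at x) v)"
    by (rule Ck_on_cong[OF assms(2) _ f'(2)]) (rule fun_cong[OF frechet_derivative_at[OF f'(1)]])
qed

lemma Cinf_on_cong:
  "open S \<Longrightarrow> Cinf_on S f \<Longrightarrow> (\<And>x. x \<in> S \<Longrightarrow> f x = g x) \<Longrightarrow> Cinf_on S g"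
  unfolding Cinf_on_def using Ck_on_cong by metis

lemma Cinf_on_compose:
  fixes h :: "'a::real_normed_vector \<Rightarrow> 'b::euclidean_space"
  shows "Cinf_on S h \<Longrightarrow> Cinf_on T g \<Longrightarrow> h ` S \<subseteq> T \<Longrightarrow> Cinf_on S (\<lambda>x. g (h x))"
  unfolding Cinf_on_def using Ck_on_compose by blast

section \<open>Charts and tangent vectors\<close>

context
  fixes A :: "'m::topological_space chart set"
  assumes atlas: "smooth_atlas A"
begin

lemma chart_inv_chart: "p \<in> fst c \<Longrightarrow> c \<in> A \<Longrightarrow> chart_inv c (snd c p) = p"
  using atlas unfolding smooth_atlas_def topological_chart_def
  by (metis homeomorphism_apply1)

lemma open_chart_domain: "c \<in> A \<Longrightarrow> open (fst c)"
  using atlas unfolding smooth_atlas_def topological_chart_def by blast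

lemma ex_chart: "\<exists>c\<in>A. p \<in> fst c"
  using atlas unfolding smooth_atlas_def by blast

lemma open_chart_image:
  assumes c: "c \<in> A" and W: "open W"
  shows "open (snd c ` (W \<inter> fst c))"
proof -
  have h: "homeomorphism (fst c) (snd c ` fst c) (snd c) (chart_inv c)" "open (snd c ` fst c)"
    using atlas c unfolding smooth_atlas_def topological_chart_def by auto
  have "openin (top_of_set (fst c)) (W \<inter> fst c)"
    using openin_open_Int[OF W] by (subst Int_commute)
  then have "openin (top_of_set (snd c ` fst c)) (snd c ` (W \<inter> fst c))"
    using homeomorphism_imp_open_map[OF h(1)] by blast
  then show ?thesis using h(2) openin_open_trans by blast
qed

lemma Cinf_on_transition:
  assumes "c \<in> A" "d \<in> A"
  shows "Cinf_on (snd d ` (fst d \<inter> fst c)) (\<lambda>x. snd c (chart_inv d x))"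
  using atlas assms unfolding smooth_atlas_def compatible_def by (auto simp: comp_def)

lemma smooth_fun_cong:
  assumes "open W" "smooth_fun A W f" "\<And>q. q \<in> W \<Longrightarrow> f q = f' q"
  shows "smooth_fun A W f'"
  unfolding smooth_fun_def
proof
  fix c assume c: "c \<in> A"
  show "Cinf_on (snd c ` (W \<inter> fst c)) (f' \<circ> chart_inv c)"
    by (rule Cinf_on_cong[OF open_chart_image[OF c assms(1)], of "f \<circ> chart_inv c"])
      (use assms(2,3) c in \<open>auto simp: smooth_fun_def chart_inv_chart\<close>)
qed

lemma smooth_fun_const: "smooth_fun A W (\<lambda>q. a)"
  unfolding smooth_fun_def Cinf_on_def comp_def by (simp add: Ck_on_const)

lemma smooth_fun_add:
  "smooth_fun A W f \<Longrightarrow> smooth_fun A W g \<Longrightarrow> smooth_fun A W (\<lambda>q. f q + g q)"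
  unfolding smooth_fun_def Cinf_on_def comp_def by (simp add: Ck_on_add)

lemma smooth_fun_mult:
  "smooth_fun A W f \<Longrightarrow> smooth_fun A W g \<Longrightarrow> smooth_fun A W (\<lambda>q. f q * g q)"
  unfolding smooth_fun_def Cinf_on_def comp_def using Ck_on_scaleR[where 'b = real] by fastforce

lemma smooth_fun_subset: "smooth_fun A W f \<Longrightarrow> V \<subseteq> W \<Longrightarrow> smooth_fun A V f"
  unfolding smooth_fun_def Cinf_on_def by (meson Ck_on_subset Int_mono image_mono order_refl)

lemma smooth_near_cong:
  assumes "open W" "p \<in> W" "\<And>q. q \<in> W \<Longrightarrow> f q = f' q"
  shows "smooth_near A p f \<longleftrightarrow> smooth_near A p f'"
proof -
  have "smooth_near A p f'" if "smooth_near A p f" and eq: "\<And>q. q \<in> W \<Longrightarrow> f q = f' q" for f f'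
  proof -
    obtain V where V: "open V" "p \<in> V" "smooth_fun A V f"
      using \<open>smooth_near A p f\<close> unfolding smooth_near_def by blast
    have "smooth_fun A (V \<inter> W) f'"
      by (rule smooth_fun_cong[of _ f]) (use V assms(1) eq smooth_fun_subset in auto)
    then show ?thesis unfolding smooth_near_def using V assms by (auto intro!: exI[of _ "V \<inter> W"])
  qed
  then show ?thesis using assms(3) by metis
qed

lemma smooth_near_differentiable:
  assumes "smooth_near A p f" "c \<in> A" "p \<in> fst c"
  shows "(f \<circ> chart_inv c) differentiable (at (snd c p))"
proof -
  obtain W where "open W" "p \<in> W" "smooth_fun A W f"
    using assms(1) unfolding smooth_near_def by blast
  then show ?thesis
    using Cinf_on_differentiable[of "snd c ` (W \<inter> fst c)"] assms unfolding smooth_fun_def by blast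
qed

lemma smooth_fun_coord:
  assumes "c \<in> A"
  shows "smooth_fun A (fst c) (coord c i)"
  unfolding smooth_fun_def
proof
  fix d assume d: "d \<in> A"
  have "Ck_on k (snd d ` (fst d \<inter> fst c)) (\<lambda>x. snd c (chart_inv d x) $ i)" for k
    using Cinf_on_transition[OF assms d] unfolding Cinf_on_def
    by (intro Ck_on_bounded_linear[OF bounded_linear_vec_nth]) auto
  then show "Cinf_on (snd d ` (fst c \<inter> fst d)) (coord c i \<circ> chart_inv d)"
    unfolding Cinf_on_def comp_def coord_def by (simp add: Int_commute)
qed

lemma smooth_near_coord: "c \<in> A \<Longrightarrow> p \<in> fst c \<Longrightarrow> smooth_near A p (coord c i)"
  unfolding smooth_near_def using smooth_fun_coord open_chart_domain by blast

lemma linear_coord_derivative: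
  assumes "smooth_near A p f" "c \<in> A" "p \<in> fst c"
  shows "linear (frechet_derivative (f \<circ> chart_inv c) (at (snd c p)))"
  using smooth_near_differentiable[OF assms] by (rule linear_frechet_derivative)

lemma coord_vec_lcomb:
  assumes "c \<in> A" "p \<in> fst c"
  shows "lcomb a (coord_vec A c p \<xi>) b (coord_vec A c p \<eta>) = coord_vec A c p (a *\<^sub>R \<xi> + b *\<^sub>R \<eta>)"
  unfolding lcomb_def coord_vec_def
  by (rule ext) (auto simp: linear_add[OF linear_coord_derivative] linear_cmul[OF linear_coord_derivative] assms)

lemma coord_vec_expand:
  assumes "c \<in> A" "p \<in> fst c"
  shows "coord_vec A c p \<xi> = (\<lambda>f. \<Sum>i\<in>UNIV. \<xi> $ i * coord_field A c i p f)"
proof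
  fix f
  show "coord_vec A c p \<xi> f = (\<Sum>i\<in>UNIV. \<xi> $ i * coord_field A c i p f)"
  proof (cases "smooth_near A p f")
    case True
    let ?L = "frechet_derivative (f \<circ> chart_inv c) (at (snd c p))"
    have lin: "linear ?L" using linear_coord_derivative[OF True assms] .
    have "?L \<xi> = ?L (\<Sum>i\<in>UNIV. \<xi> $ i *\<^sub>R axis i 1)"
      using basis_expansion[of \<xi>] by (simp add: scalar_mult_eq_scaleR)
    also have "\<dots> = (\<Sum>i\<in>UNIV. \<xi> $ i * ?L (axis i 1))"
      by (simp add: linear_sum[OF lin] linear_cmul[OF lin])
    finally show ?thesis using True by (simp add: coord_vec_def coord_field_def)
  qed (simp add: coord_vec_def coord_field_def)
qed

text \<open>The chain rule for \<open>f \<circ> d\<^sup>-\<^sup>1 = (f \<circ> c\<^sup>-\<^sup>1) \<circ> (c \<circ> d\<^sup>-\<^sup>1)\<close>: components change by the derivative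
  of the transition map.\<close>

lemma coord_vec_change:
  assumes "c \<in> A" "d \<in> A" "p \<in> fst c" "p \<in> fst d"
  shows "\<exists>\<eta>. coord_vec A d p \<xi> = coord_vec A c p \<eta>"
proof -
  let ?t = "\<lambda>x. snd c (chart_inv d x)"
  let ?S = "snd d ` (fst c \<inter> fst d)"
  have t: "(?t has_derivative frechet_derivative ?t (at (snd d p))) (at (snd d p))"
    using Cinf_on_differentiable[OF Cinf_on_transition[OF assms(1,2)], of "snd d p"] assms
    by (simp only: frechet_derivative_works[symmetric]) blast
  have S: "open ?S" "snd d p \<in> ?S"
    using open_chart_image[OF assms(2) open_chart_domain[OF assms(1)]] assms by auto
  have "frechet_derivative (f \<circ> chart_inv d) (at (snd d p)) \<xi> =
      frechet_derivative (f \<circ> chart_inv c) (at (snd c p)) (frechet_derivative ?t (at (snd d p)) \<xi>)"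
    if f: "smooth_near A p f" for f
  proof -
    have t_p: "?t (snd d p) = snd c p" using assms by (simp add: chart_inv_chart)
    have "((f \<circ> chart_inv c) has_derivative frechet_derivative (f \<circ> chart_inv c) (at (snd c p)))
        (at (?t (snd d p)))"
      using smooth_near_differentiable[OF f assms(1,3)] by (simp only: t_p frechet_derivative_works)
    from has_derivative_compose[OF t this]
    have "((\<lambda>x. (f \<circ> chart_inv c) (?t x)) has_derivative (\<lambda>v.
        frechet_derivative (f \<circ> chart_inv c) (at (snd c p)) (frechet_derivative ?t (at (snd d p)) v)))
        (at (snd d p))" .
    then have "((f \<circ> chart_inv d) has_derivative (\<lambda>v.
        frechet_derivative (f \<circ> chart_inv c) (at (snd c p)) (frechet_derivative ?t (at (snd d p)) v)))
        (at (snd d p))"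
      by (rule has_derivative_transform_within_open[OF _ S]) (use assms in \<open>auto simp: chart_inv_chart\<close>)
    from fun_cong[OF frechet_derivative_at[OF this], of \<xi>] show ?thesis by simp
  qed
  then show ?thesis unfolding coord_vec_def by (intro exI ext) auto
qed

lemma tangent_coord_vec:
  assumes "c \<in> A" "p \<in> fst c"
  shows "tangent A p = range (coord_vec A c p)"
  unfolding tangent_def using coord_vec_change[OF assms(1) _ assms(2)] assms by blast

lemma lcomb_tangent:
  assumes "u \<in> tangent A p" "v \<in> tangent A p"
  shows "lcomb a u b v \<in> tangent A p"
proof -
  obtain c where c: "c \<in> A" "p \<in> fst c" using ex_chart by blast
  show ?thesis
    using assms unfolding tangent_coord_vec[OF c] by (auto simp: coord_vec_lcomb[OF c])
qed

lemma zero_tangent: "(\<lambda>f. 0) \<in> tangent A p"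
proof -
  obtain c where c: "c \<in> A" "p \<in> fst c" using ex_chart by blast
  have "coord_vec A c p 0 = (\<lambda>f. 0)"
    unfolding coord_vec_def by (auto simp: linear_0[OF linear_coord_derivative[OF _ c]])
  then show ?thesis unfolding tangent_coord_vec[OF c] by (metis rangeI)
qed

lemma coord_vec_coord:
  assumes "c \<in> A" "p \<in> fst c"
  shows "coord_vec A c p \<xi> (coord c i) = \<xi> $ i"
proof -
  have "((\<lambda>x. x $ i) has_derivative (\<lambda>x. x $ i)) (at (snd c p))"
    by (rule bounded_linear_imp_has_derivative[OF bounded_linear_vec_nth])
  then have "((coord c i \<circ> chart_inv c) has_derivative (\<lambda>x. x $ i)) (at (snd c p))"
    by (rule has_derivative_transform_within_open
        [OF _ open_chart_image[OF assms(1) open_chart_domain[OF assms(1)]]])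
      (use assms in \<open>auto simp: coord_def chart_inv_chart\<close>)
  then have "frechet_derivative (coord c i \<circ> chart_inv c) (at (snd c p)) = (\<lambda>x. x $ i)"
    by (rule frechet_derivative_at[symmetric])
  then show ?thesis using smooth_near_coord[OF assms] by (simp add: coord_vec_def)
qed

lemma tangent_const:
  assumes "v \<in> tangent A p"
  shows "v (\<lambda>q. a) = 0"
  using assms unfolding tangent_def coord_vec_def by (auto simp: comp_def)

text \<open>Tangent vectors only depend on germs; this allows identities between functions that are known to
  hold only where a vector field is tangent.\<close>

lemma tangent_local:
  assumes v: "v \<in> tangent A p" and W: "open W" "p \<in> W" and eq: "\<And>q. q \<in> W \<Longrightarrow> f q = f' q"
  shows "v f = v f'"
proof -
  obtain c \<xi> where c: "c \<in> A" "p \<in> fst c" and v_eq: "v = coord_vec A c p \<xi>"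
    using v unfolding tangent_def by blast
  note near = smooth_near_cong[OF W eq]
  show ?thesis
  proof (cases "smooth_near A p f")
    case True
    have "((f \<circ> chart_inv c) has_derivative frechet_derivative (f \<circ> chart_inv c) (at (snd c p))) (at (snd c p))"
      using smooth_near_differentiable[OF True c] by (simp only: frechet_derivative_works)
    then have "((f' \<circ> chart_inv c) has_derivative frechet_derivative (f \<circ> chart_inv c) (at (snd c p))) (at (snd c p))"
      by (rule has_derivative_transform_within_open[OF _ open_chart_image[OF c(1) W(1)]])
        (use c W eq in \<open>auto simp: chart_inv_chart\<close>)
    then have "frechet_derivative (f' \<circ> chart_inv c) (at (snd c p)) = frechet_derivative (f \<circ> chart_inv c) (at (snd c p))"
      by (rule frechet_derivative_at[symmetric])
    then show ?thesis using near by (simp add: v_eq coord_vec_def)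
  qed (use near in \<open>simp add: v_eq coord_vec_def\<close>)
qed

text \<open>Every tangent vector at a point of a chart domain extends to a smooth field there, namely the
  one with constant components.\<close>

lemma smooth_vf_coord_vec:
  assumes c: "c \<in> A"
  shows "smooth_vf A (fst c) (\<lambda>q. coord_vec A c q \<xi>)"
  unfolding smooth_vf_def
proof (intro conjI ballI allI impI)
  show "coord_vec A c q \<xi> \<in> tangent A q" if "q \<in> fst c" for q
    using that c unfolding tangent_def by blast
next
  fix W f assume W: "open W" "W \<subseteq> fst c" and f: "smooth_fun A W f"
  define D where "D = (\<lambda>y. frechet_derivative (f \<circ> chart_inv c) (at y) \<xi>)"
  have D: "Cinf_on (snd c ` (W \<inter> fst c)) D"
    unfolding D_def
    using f c by (intro Cinf_on_frechet_derivative open_chart_image[OF c W(1)]) (simp add: smooth_fun_def)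
  show "smooth_fun A W (\<lambda>q. coord_vec A c q \<xi> f)"
    unfolding smooth_fun_def
  proof
    fix d assume d: "d \<in> A"
    let ?S = "snd d ` (W \<inter> fst d)"
    have "Cinf_on ?S (\<lambda>x. snd c (chart_inv d x))"
      using Cinf_on_transition[OF c d] W(2) unfolding Cinf_on_def
      by (auto intro: Ck_on_subset)
    then have "Cinf_on ?S (\<lambda>x. D (snd c (chart_inv d x)))"
      by (rule Cinf_on_compose[OF _ D]) (use W d in \<open>auto simp: chart_inv_chart\<close>)
    then show "Cinf_on ?S ((\<lambda>q. coord_vec A c q \<xi> f) \<circ> chart_inv d)"
      by (rule Cinf_on_cong[OF open_chart_image[OF d W(1)]])
        (use W d f in \<open>auto simp: chart_inv_chart coord_vec_def D_def smooth_near_def\<close>)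
  qed
qed

lemma smooth_vf_coord_field: "c \<in> A \<Longrightarrow> smooth_vf A (fst c) (coord_field A c i)"
  unfolding coord_field_def by (rule smooth_vf_coord_vec)

lemma smooth_vf_subset: "smooth_vf A U X \<Longrightarrow> V \<subseteq> U \<Longrightarrow> smooth_vf A V X"
  unfolding smooth_vf_def by (meson in_mono order_trans)

lemma smooth_vf_lcomb:
  assumes "smooth_vf A U X" "smooth_vf A U Y" "smooth_fun A U a" "smooth_fun A U b"
  shows "smooth_vf A U (\<lambda>q. lcomb (a q) (X q) (b q) (Y q))"
  unfolding smooth_vf_def
proof (intro conjI ballI allI impI)
  fix q assume "q \<in> U"
  then show "lcomb (a q) (X q) (b q) (Y q) \<in> tangent A q"
    using assms(1,2) by (intro lcomb_tangent) (auto simp: smooth_vf_def)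
next
  fix W f assume W: "open W" "W \<subseteq> U" and f: "smooth_fun A W f"
  have "smooth_fun A W (\<lambda>p. X p f)" "smooth_fun A W (\<lambda>p. Y p f)"
    using assms(1,2) W f by (auto simp: smooth_vf_def)
  then show "smooth_fun A W (\<lambda>p. lcomb (a p) (X p) (b p) (Y p) f)"
    unfolding lcomb_def
    by (intro smooth_fun_add smooth_fun_mult smooth_fun_subset[OF assms(3) W(2)]
        smooth_fun_subset[OF assms(4) W(2)])
qed

lemma eventually_in_chart:
  assumes "c \<in> A" "\<gamma> s \<in> fst c" "s \<in> I" "continuous_on I \<gamma>"
  shows "\<forall>\<^sub>F r in at s within I. r \<in> I \<and> \<gamma> r \<in> fst c"
proof -
  have "(\<gamma> \<longlongrightarrow> \<gamma> s) (at s within I)" using assms(3,4) by (simp add: continuous_on)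
  then have "\<forall>\<^sub>F r in at s within I. \<gamma> r \<in> fst c"
    using topological_tendstoD open_chart_domain[OF assms(1)] assms(2) by blast
  moreover have "\<forall>\<^sub>F r in at s within I. r \<in> I" by (simp add: eventually_at_filter)
  ultimately show ?thesis by eventually_elim simp
qed

text \<open>The chain rule for \<open>f \<circ> \<gamma> = (f \<circ> c\<^sup>-\<^sup>1) \<circ> (c \<circ> \<gamma>)\<close>, valid near \<open>s\<close>, where \<open>\<gamma>\<close> stays in the chart
  domain.\<close>

lemma has_derivative_along_curve:
  assumes c: "c \<in> A" "\<gamma> s \<in> fst c" and s: "s \<in> I" and cont: "continuous_on I \<gamma>"
    and d: "((snd c \<circ> \<gamma>) has_vector_derivative \<xi>) (at s within I)"
    and f: "smooth_near A (\<gamma> s) f"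
  shows "((f \<circ> \<gamma>) has_real_derivative coord_vec A c (\<gamma> s) \<xi> f) (at s within I)"
proof -
  let ?L = "frechet_derivative (f \<circ> chart_inv c) (at (snd c (\<gamma> s)))"
  have L: "((f \<circ> chart_inv c) has_derivative ?L) (at ((snd c \<circ> \<gamma>) s))"
    using smooth_near_differentiable[OF f c] by (simp only: comp_apply frechet_derivative_works)
  have "((\<lambda>r. (f \<circ> chart_inv c) ((snd c \<circ> \<gamma>) r)) has_derivative (\<lambda>r. ?L (r *\<^sub>R \<xi>))) (at s within I)"
    using has_derivative_compose[OF d[unfolded has_vector_derivative_def] L] .
  moreover have "\<forall>\<^sub>F r in at s within I. (f \<circ> chart_inv c) ((snd c \<circ> \<gamma>) r) = (f \<circ> \<gamma>) r"
    by (rule eventually_mono[OF eventually_in_chart[OF c s cont]]) (simp add: chart_inv_chart c)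
  ultimately have "((f \<circ> \<gamma>) has_derivative (\<lambda>r. ?L (r *\<^sub>R \<xi>))) (at s within I)"
    by (rule has_derivative_transform_eventually) (use c s in \<open>auto simp: chart_inv_chart\<close>)
  moreover have "(\<lambda>r. ?L (r *\<^sub>R \<xi>)) = (*) (?L \<xi>)"
    by (rule ext) (simp add: linear_cmul[OF linear_coord_derivative[OF f c]])
  ultimately show ?thesis using f by (simp add: has_field_derivative_def coord_vec_def)
qed

lemma velocity_eq_coord_vec:
  assumes "c \<in> A" "\<gamma> s \<in> fst c" "s \<in> I" "continuous_on I \<gamma>"
    and "((snd c \<circ> \<gamma>) has_vector_derivative \<xi>) (at s within I)"
    and "at s within I \<noteq> bot"
  shows "velocity A \<gamma> I s = coord_vec A c (\<gamma> s) \<xi>"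
proof
  fix f
  show "velocity A \<gamma> I s f = coord_vec A c (\<gamma> s) \<xi> f"
  proof (cases "smooth_near A (\<gamma> s) f")
    case True
    from has_derivative_along_curve[OF assms(1-5) True]
    show ?thesis
      using True vector_derivative_within[OF assms(6)]
      by (simp add: velocity_def has_real_derivative_iff_has_vector_derivative)
  qed (simp add: velocity_def coord_vec_def)
qed

end

section \<open>The Riemannian extension of the metric\<close>

context
  fixes M :: "('m::{t2_space, second_countable_topology}) csr"
  assumes csr: "contact_sub_riemannian M"
begin

lemma smooth_atlas_csr: "smooth_atlas (atlas M)"
  and one_form_csr: "one_form M"
  and metric_csr: "sub_riemannian_metric M"
  and reeb_csr: "reeb_field M"
  and levi_civita_csr: "levi_civita_connection M"
  and J_tau_csr: "J_tau_operators M"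
  and srconn_csr: "sub_riemannian_connection M"
  using csr by (simp_all add: contact_sub_riemannian_def contact_form_def)

lemma form_lcomb:
  "u \<in> tan_sp M p \<Longrightarrow> v \<in> tan_sp M p \<Longrightarrow>
     form M p (lcomb a u b v) = a * form M p u + b * form M p v"
  using one_form_csr unfolding one_form_def by blast

lemma reeb_tangent: "reeb M p \<in> tan_sp M p"
  using reeb_csr unfolding reeb_field_def smooth_vf_def by blast

lemma form_reeb: "form M p (reeb M p) = 1"
  using reeb_csr unfolding reeb_field_def by blast

lemma form_zero: "form M p (\<lambda>f. 0) = 0"
  using form_lcomb[OF reeb_tangent reeb_tangent, of p 0 0] by (simp add: lcomb_def)

lemma zero_horiz: "(\<lambda>f. 0) \<in> horiz M p"
  unfolding horiz_def using zero_tangent[OF smooth_atlas_csr] form_zero by simp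

lemma hproj_horiz: "v \<in> tan_sp M p \<Longrightarrow> hproj M p v \<in> horiz M p"
  unfolding horiz_def hproj_def
  by (simp add: lcomb_tangent[OF smooth_atlas_csr] reeb_tangent form_lcomb form_reeb)

lemma hproj_reeb: "hproj M p (reeb M p) = (\<lambda>f. 0)"
  unfolding hproj_def form_reeb by (simp add: lcomb_def)

lemma hproj_lcomb:
  "u \<in> tan_sp M p \<Longrightarrow> v \<in> tan_sp M p \<Longrightarrow>
     hproj M p (lcomb a u b v) = lcomb a (hproj M p u) b (hproj M p v)"
  by (rule ext) (simp add: hproj_def form_lcomb, simp add: lcomb_def algebra_simps)

lemma hmetric_sym: "u \<in> horiz M p \<Longrightarrow> v \<in> horiz M p \<Longrightarrow> hmetric M p u v = hmetric M p v u"
  using metric_csr[unfolded sub_riemannian_metric_def, THEN conjunct1] by simp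

lemma hmetric_lcomb:
  "u \<in> horiz M p \<Longrightarrow> v \<in> horiz M p \<Longrightarrow> w \<in> horiz M p \<Longrightarrow>
     hmetric M p (lcomb a u b v) w = a * hmetric M p u w + b * hmetric M p v w"
  using metric_csr[unfolded sub_riemannian_metric_def, THEN conjunct1] by simp

lemma hmetric_zero: "w \<in> horiz M p \<Longrightarrow> hmetric M p (\<lambda>f. 0) w = 0"
  using hmetric_lcomb[OF zero_horiz zero_horiz, of w p 0 0] by (simp add: lcomb_def)

lemma gmet_sym: "u \<in> tan_sp M p \<Longrightarrow> v \<in> tan_sp M p \<Longrightarrow> gmet M p u v = gmet M p v u"
  unfolding gmet_def using hmetric_sym hproj_horiz by (metis mult.commute)

lemma gmet_lcomb:
  "u \<in> tan_sp M p \<Longrightarrow> v \<in> tan_sp M p \<Longrightarrow> w \<in> tan_sp M p \<Longrightarrow>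
     gmet M p (lcomb a u b v) w = a * gmet M p u w + b * gmet M p v w"
  unfolding gmet_def by (simp add: hproj_lcomb form_lcomb hmetric_lcomb hproj_horiz algebra_simps)

lemma gmet_zero: "w \<in> tan_sp M p \<Longrightarrow> gmet M p (\<lambda>f. 0) w = 0"
  using gmet_lcomb[OF reeb_tangent reeb_tangent, of w p 0 0] by (simp add: lcomb_def)

lemma gmet_reeb: "v \<in> tan_sp M p \<Longrightarrow> gmet M p (reeb M p) v = form M p v"
  unfolding gmet_def hproj_reeb form_reeb by (simp add: hmetric_zero hproj_horiz)

lemma gmet_reeb_right: "v \<in> tan_sp M p \<Longrightarrow> gmet M p v (reeb M p) = form M p v"
  using gmet_reeb gmet_sym reeb_tangent by metis

lemma gmet_definite:
  assumes v: "v \<in> tan_sp M p" and eq: "gmet M p v v = 0"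
  shows "v = (\<lambda>f. 0)"
proof -
  have pos: "w \<noteq> (\<lambda>f. 0) \<Longrightarrow> hmetric M p w w > 0" if "w \<in> horiz M p" for w
    using that metric_csr[unfolded sub_riemannian_metric_def, THEN conjunct2, THEN conjunct1] by blast
  have nn: "hmetric M p (hproj M p v) (hproj M p v) \<ge> 0"
    using pos[OF hproj_horiz[OF v]] hmetric_zero[OF zero_horiz, of p] by fastforce
  have "form M p v = 0"
    using eq nn unfolding gmet_def
    by (metis add_nonneg_eq_0_iff mult_eq_0_iff zero_le_square)
  moreover have "hmetric M p (hproj M p v) (hproj M p v) = 0"
    using eq calculation unfolding gmet_def by simp
  then have "hproj M p v = (\<lambda>f. 0)"
    using pos[OF hproj_horiz[OF v]] by force
  ultimately show ?thesis unfolding hproj_def by (simp add: lcomb_def)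
qed

lemma tangent_gmet_sum:
  assumes "finite B" "\<And>i. i \<in> B \<Longrightarrow> v i \<in> tan_sp M p" "w \<in> tan_sp M p"
  shows "(\<lambda>f. \<Sum>i\<in>B. a i * v i f) \<in> tan_sp M p \<and>
         gmet M p (\<lambda>f. \<Sum>i\<in>B. a i * v i f) w = (\<Sum>i\<in>B. a i * gmet M p (v i) w)"
  using assms(1,2)
proof (induction B rule: finite_induct)
  case empty
  then show ?case using zero_tangent[OF smooth_atlas_csr] gmet_zero assms(3) by simp
next
  case (insert j B)
  have eq: "(\<lambda>f. \<Sum>i\<in>insert j B. a i * v i f) = lcomb (a j) (v j) 1 (\<lambda>f. \<Sum>i\<in>B. a i * v i f)"
    using insert.hyps by (simp add: lcomb_def)
  have v: "v j \<in> tan_sp M p" and IH: "(\<lambda>f. \<Sum>i\<in>B. a i * v i f) \<in> tan_sp M p"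
      "gmet M p (\<lambda>f. \<Sum>i\<in>B. a i * v i f) w = (\<Sum>i\<in>B. a i * gmet M p (v i) w)"
    using insert by auto
  show ?case
    unfolding eq using insert.hyps
    by (simp add: lcomb_tangent[OF smooth_atlas_csr v IH(1)] gmet_lcomb[OF v IH(1) assms(3)] IH(2))
qed

text \<open>The tangent space is three-dimensional: expressed in components, the map
  \<open>v \<mapsto> (g(v, e\<^sub>j))\<^sub>j\<close> is a linear endomorphism of \<open>\<real>\<^sup>3\<close>; orthonormality of the \<open>e\<^sub>j\<close> makes it
  surjective, hence it is injective.\<close>

lemma orthonormal_complete:
  fixes e :: "3 \<Rightarrow> 'm tvec"
  assumes e: "\<And>i. e i \<in> tan_sp M p"
    and on: "\<And>i j. gmet M p (e i) (e j) = (if i = j then 1 else 0)"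
    and v: "v \<in> tan_sp M p" "\<And>j. gmet M p v (e j) = 0"
  shows "v = (\<lambda>f. 0)"
proof -
  obtain c where c: "c \<in> atlas M" "p \<in> fst c" using ex_chart[OF smooth_atlas_csr] by blast
  note tan = tangent_coord_vec[OF smooth_atlas_csr c]
  have field: "coord_field (atlas M) c i p \<in> tan_sp M p" for i
    unfolding coord_field_def tan by simp
  define L :: "real ^ 3 \<Rightarrow> real ^ 3"
    where "L = (\<lambda>\<xi>. \<chi> j. \<Sum>i\<in>UNIV. \<xi> $ i * gmet M p (coord_field (atlas M) c i p) (e j))"
  have L: "L \<xi> $ j = gmet M p (coord_vec (atlas M) c p \<xi>) (e j)" for \<xi> j
    unfolding coord_vec_expand[OF smooth_atlas_csr c] L_def
    using tangent_gmet_sum[of UNIV "\<lambda>i. coord_field (atlas M) c i p" p "e j"] field e by simp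
  have lin: "linear L"
    unfolding L_def
    by (rule linearI) (simp_all add: vec_eq_iff sum.distrib sum_distrib_left algebra_simps)
  obtain \<xi> where \<xi>: "\<And>i. e i = coord_vec (atlas M) c p (\<xi> i)" using e unfolding tan image_iff by metis
  have "L (\<xi> i) = axis i 1" for i
    unfolding vec_eq_iff L by (simp add: \<xi>[symmetric] on axis_def)
  then have "L (\<Sum>i\<in>UNIV. y $ i *\<^sub>R \<xi> i) = y" for y
    using basis_expansion[of y]
    by (simp add: linear_sum[OF lin] linear_cmul[OF lin] scalar_mult_eq_scaleR)
  then have "surj L" by (rule surjI)
  then have "inj L" using linear_surjective_imp_injective[OF lin] by blast
  obtain \<alpha> where \<alpha>: "v = coord_vec (atlas M) c p \<alpha>" using v(1) tan by blast
  have "L \<alpha> = 0" unfolding vec_eq_iff L by (simp add: \<alpha>[symmetric] v(2))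
  then have "\<alpha> = 0" using \<open>inj L\<close> linear_injective_0[OF lin] by blast
  then show ?thesis unfolding \<alpha> coord_vec_expand[OF smooth_atlas_csr c] by simp
qed

lemma smooth_form:
  assumes "open U" "smooth_vf (atlas M) U X"
  shows "smooth_fun (atlas M) U (\<lambda>p. form M p (X p))"
  using one_form_csr[unfolded one_form_def, THEN conjunct2, rule_format, OF assms] .

lemma smooth_vf_reeb: "smooth_vf (atlas M) U (reeb M)"
  using smooth_vf_subset[OF smooth_atlas_csr reeb_csr[unfolded reeb_field_def, THEN conjunct1]] by simp

lemma smooth_vf_hproj:
  assumes "open U" "smooth_vf (atlas M) U X"
  shows "smooth_vf (atlas M) U (\<lambda>p. hproj M p (X p))"
proof -
  have "smooth_fun (atlas M) U (\<lambda>p. form M p (X p))"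
    by (rule smooth_form[OF assms])
  then have "smooth_fun (atlas M) U (\<lambda>p. - form M p (X p))"
    using smooth_fun_mult[OF smooth_atlas_csr smooth_fun_const[OF smooth_atlas_csr, of U "-1"]] by fastforce
  then show ?thesis
    unfolding hproj_def
    using smooth_vf_lcomb[OF smooth_atlas_csr assms(2) smooth_vf_reeb] smooth_fun_const[OF smooth_atlas_csr] by blast
qed

lemma smooth_gmet:
  assumes U: "open U" and X: "smooth_vf (atlas M) U X" and Y: "smooth_vf (atlas M) U Y"
  shows "smooth_fun (atlas M) U (\<lambda>p. gmet M p (X p) (Y p))"
proof -
  have "smooth_fun (atlas M) U (\<lambda>p. form M p (X p))" "smooth_fun (atlas M) U (\<lambda>p. form M p (Y p))"
    by (rule smooth_form[OF U X] smooth_form[OF U Y])+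
  moreover have "smooth_fun (atlas M) U (\<lambda>p. hmetric M p (hproj M p (X p)) (hproj M p (Y p)))"
  proof -
    have "\<forall>p\<in>U. hproj M p (X p) \<in> horiz M p \<and> hproj M p (Y p) \<in> horiz M p"
      using X Y by (auto simp: smooth_vf_def intro: hproj_horiz)
    then show ?thesis
      using metric_csr[unfolded sub_riemannian_metric_def, THEN conjunct2, THEN conjunct2, rule_format,
          OF U smooth_vf_hproj[OF U X] smooth_vf_hproj[OF U Y]] by blast
  qed
  ultimately show ?thesis
    unfolding gmet_def
    by (intro smooth_fun_add[OF smooth_atlas_csr] smooth_fun_mult[OF smooth_atlas_csr])
qed

section \<open>The Reeb field is parallel\<close>

lemma metric_connection_tangent:
  assumes "metric_connection M D" "open U" "p \<in> U" "smooth_vf (atlas M) U Y" "v \<in> tan_sp M p"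
  shows "D p v Y \<in> tan_sp M p"
  using assms(1)[unfolded metric_connection_def, THEN conjunct1, rule_format, OF assms(2,3,4,4)]
    assms(5) by blast

lemma metric_connection_product:
  assumes "metric_connection M D" "open U" "p \<in> U" "smooth_vf (atlas M) U Y"
    "smooth_vf (atlas M) U Z" "v \<in> tan_sp M p"
  shows "v (\<lambda>q. gmet M q (Y q) (Z q)) = gmet M p (D p v Y) (Z p) + gmet M p (Y p) (D p v Z)"
  using assms(1)[unfolded metric_connection_def, THEN conjunct1, rule_format, OF assms(2,3,4,5)]
    assms(6) by blast

lemma levi_civita_metric: "metric_connection M (levi_civita M)"
  using levi_civita_csr by (simp add: levi_civita_connection_def)

lemma srconn_metric: "metric_connection M (srconn M)"
  using srconn_csr by (simp add: sub_riemannian_connection_def)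

text \<open>Differentiate \<open>g(T, T) = 1\<close>.\<close>

lemma derivative_reeb_orthogonal_reeb:
  assumes D: "metric_connection M D" and v: "v \<in> tan_sp M p"
  shows "gmet M p (D p v (reeb M)) (reeb M p) = 0"
proof -
  have tan: "D p v (reeb M) \<in> tan_sp M p"
    by (rule metric_connection_tangent[OF D open_UNIV UNIV_I smooth_vf_reeb v])
  have "gmet M q (reeb M q) (reeb M q) = 1" for q
    using gmet_reeb[OF reeb_tangent] form_reeb by simp
  then have "v (\<lambda>q. gmet M q (reeb M q) (reeb M q)) = 0"
    using tangent_const[OF smooth_atlas_csr v] by simp
  then show ?thesis
    using metric_connection_product[OF D open_UNIV UNIV_I smooth_vf_reeb smooth_vf_reeb v]
      gmet_sym[OF tan reeb_tangent] by simp
qed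

text \<open>Torsion and the metric property are stated for fields, so vectors at a point are extended to a
  common neighbourhood before they are used.\<close>

lemma tangent_extension:
  assumes "v \<in> tan_sp M p" "w \<in> tan_sp M p"
  obtains U X Z where "open U" "p \<in> U" "smooth_vf (atlas M) U X" "X p = v"
    "smooth_vf (atlas M) U Z" "Z p = w"
proof -
  obtain c where c: "c \<in> atlas M" "p \<in> fst c" using ex_chart[OF smooth_atlas_csr] by blast
  obtain \<xi> \<eta> where "v = coord_vec (atlas M) c p \<xi>" "w = coord_vec (atlas M) c p \<eta>"
    using assms tangent_coord_vec[OF smooth_atlas_csr c] by blast
  then show thesis
    using that[of "fst c" "\<lambda>q. coord_vec (atlas M) c q \<xi>" "\<lambda>q. coord_vec (atlas M) c q \<eta>"]
      open_chart_domain[OF smooth_atlas_csr c(1)] c smooth_vf_coord_vec[OF smooth_atlas_csr c(1)]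
    by blast
qed

text \<open>The Reeb orbits are geodesics: \<open>g(D\<^sub>TT, X) = T(\<omega>(X)) - g(T, D\<^sub>TX)\<close>, and by the Reeb
  condition \<open>T(\<omega>(X)) = \<omega>([T,X]) = g(T, D\<^sub>TX) - g(T, D\<^sub>XT)\<close>, where the last term vanishes because
  \<open>T\<close> has constant length.\<close>

lemma reeb_geodesic:
  assumes w: "w \<in> tan_sp M p"
  shows "gmet M p (levi_civita M p (reeb M p) (reeb M)) w = 0"
proof -
  obtain U X where U: "open U" "p \<in> U" and X: "smooth_vf (atlas M) U X" "X p = w"
    using tangent_extension[OF w w] by metis
  note T = smooth_vf_reeb[of U]
  let ?DTX = "levi_civita M p (reeb M p) X" and ?DXT = "levi_civita M p w (reeb M)"
  have tan: "?DTX \<in> tan_sp M p" "?DXT \<in> tan_sp M p"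
    using metric_connection_tangent[OF levi_civita_metric U] X(1) T reeb_tangent w by blast+
  have torsion_free: "torsion M (levi_civita M) (reeb M) X p = (\<lambda>f. 0)"
    using levi_civita_csr[unfolded levi_civita_connection_def, THEN conjunct2, rule_format, OF U(1) T X(1) U(2)] .
  have "lie (atlas M) (reeb M) X p = lcomb 1 ?DTX (-1) ?DXT"
  proof
    fix f
    show "lie (atlas M) (reeb M) X p f = lcomb 1 ?DTX (-1) ?DXT f"
      using fun_cong[OF torsion_free, of f] unfolding torsion_def lcomb_def X(2) by simp
  qed
  then have lie: "form M p (lie (atlas M) (reeb M) X p) = form M p ?DTX - form M p ?DXT"
    by (simp add: form_lcomb tan)
  have "form M p ?DXT = 0"
    using derivative_reeb_orthogonal_reeb[OF levi_civita_metric w] gmet_reeb_right[OF tan(2)] by simp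
  moreover have "reeb M p (\<lambda>q. form M q (X q)) = form M p (lie (atlas M) (reeb M) X p)"
    using reeb_csr[unfolded reeb_field_def, THEN conjunct2, THEN conjunct2, rule_format, OF U(1) X(1) U(2)]
    by simp
  moreover have "reeb M p (\<lambda>q. form M q (X q)) = reeb M p (\<lambda>q. gmet M q (reeb M q) (X q))"
    using X(1) by (intro tangent_local[OF smooth_atlas_csr reeb_tangent U])
      (auto simp: smooth_vf_def gmet_reeb)
  moreover have "reeb M p (\<lambda>q. gmet M q (reeb M q) (X q)) =
      gmet M p (levi_civita M p (reeb M p) (reeb M)) w + gmet M p (reeb M p) ?DTX"
    using metric_connection_product[OF levi_civita_metric U T X(1) reeb_tangent] X(2) by simp
  ultimately show ?thesis using lie gmet_reeb[OF tan(1)] by simp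
qed

text \<open>The torsion of \<open>\<nabla>\<close> paired with \<open>w\<close>: since \<open>D\<close> is torsion-free, \<open>[X,Y] = D\<^sub>XY - D\<^sub>YX\<close>, which removes
  the bracket and leaves an identity between the two connections.\<close>

lemma torsion_difference:
  assumes U: "open U" "p \<in> U" and X: "smooth_vf (atlas M) U X" and Y: "smooth_vf (atlas M) U Y"
    and w: "w \<in> tan_sp M p"
  shows "gmet M p (srconn M p (X p) Y) w - gmet M p (srconn M p (Y p) X) w
      - gmet M p (levi_civita M p (X p) Y) w + gmet M p (levi_civita M p (Y p) X) w
    = form M p (X p) * gmet M p (tauop M p (Y p)) w - form M p (Y p) * gmet M p (tauop M p (X p)) w
      + 2 * gmet M p (Jop M p (X p)) (Y p) * form M p w"
proof -
  have XY: "X p \<in> tan_sp M p" "Y p \<in> tan_sp M p" using X Y U by (auto simp: smooth_vf_def)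
  have tau: "tauop M p (X p) \<in> tan_sp M p" "tauop M p (Y p) \<in> tan_sp M p"
    using J_tau_csr XY unfolding J_tau_operators_def by blast+
  let ?S1 = "srconn M p (X p) Y" and ?S2 = "srconn M p (Y p) X"
  let ?D1 = "levi_civita M p (X p) Y" and ?D2 = "levi_civita M p (Y p) X"
  have tan: "?S1 \<in> tan_sp M p" "?S2 \<in> tan_sp M p" "?D1 \<in> tan_sp M p" "?D2 \<in> tan_sp M p"
    using metric_connection_tangent[OF srconn_metric U] metric_connection_tangent[OF levi_civita_metric U] X Y XY by blast+
  have tD: "torsion M (levi_civita M) X Y p = (\<lambda>f. 0)"
    using levi_civita_csr[unfolded levi_civita_connection_def, THEN conjunct2, rule_format, OF U(1) X Y U(2)] .
  have tS: "torsion M (srconn M) X Y p =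
           (\<lambda>f. gmet M p (X p) (reeb M p) * tauop M p (Y p) f
              - gmet M p (Y p) (reeb M p) * tauop M p (X p) f
              + 2 * gmet M p (Jop M p (X p)) (Y p) * reeb M p f)"
    using srconn_csr[unfolded sub_riemannian_connection_def, THEN conjunct2, rule_format, OF U(1) X Y U(2)] .
  have "lcomb 1 (lcomb 1 ?S1 (-1) ?S2) (-1) (lcomb 1 ?D1 (-1) ?D2) =
      lcomb 1 (lcomb (form M p (X p)) (tauop M p (Y p)) (- form M p (Y p)) (tauop M p (X p)))
        (2 * gmet M p (Jop M p (X p)) (Y p)) (reeb M p)"
  proof
    fix f
    show "lcomb 1 (lcomb 1 ?S1 (-1) ?S2) (-1) (lcomb 1 ?D1 (-1) ?D2) f =
      lcomb 1 (lcomb (form M p (X p)) (tauop M p (Y p)) (- form M p (Y p)) (tauop M p (X p)))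
        (2 * gmet M p (Jop M p (X p)) (Y p)) (reeb M p) f"
      using fun_cong[OF tD, of f] fun_cong[OF tS, of f]
      unfolding torsion_def lcomb_def gmet_reeb_right[OF XY(1)] gmet_reeb_right[OF XY(2)] by simp
  qed
  from arg_cong[OF this, of "\<lambda>u. gmet M p u w"] show ?thesis
    by (simp add: gmet_lcomb lcomb_tangent[OF smooth_atlas_csr] tan tau reeb_tangent w gmet_reeb)
qed

text \<open>Two metric connections differ by a tensor \<open>g(\<nabla>\<^sub>XY - D\<^sub>XY, Z)\<close> that is antisymmetric in \<open>Y\<close>,
  \<open>Z\<close>, so the Koszul argument recovers it from the torsion.  For the arguments \<open>v\<close>, \<open>T\<close>, \<open>w\<close>, and
  with \<open>D\<^sub>TT = 0\<close>, the alternating sum of the three cyclic torsion terms is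
  \<open>2 g(\<nabla>\<^sub>vT - D\<^sub>vT, w) = - 2 g(\<tau>(v) + J(v), w)\<close>; but \<open>\<tau>(v) + J(v) = D\<^sub>vT\<close>, as \<open>\<tau>\<close> and \<open>J\<close> are the
  symmetric and antisymmetric parts of \<open>v \<mapsto> D\<^sub>vT\<close>.\<close>

lemma reeb_parallel:
  assumes v: "v \<in> tan_sp M p"
  shows "srconn M p v (reeb M) = (\<lambda>f. 0)"
proof -
  have orth: "gmet M p (srconn M p v (reeb M)) w = 0" if w: "w \<in> tan_sp M p" for w
  proof -
    obtain U X Z where U: "open U" "p \<in> U" and X: "smooth_vf (atlas M) U X" "X p = v"
      and Z: "smooth_vf (atlas M) U Z" "Z p = w"
      using tangent_extension[OF v w] by metis
    note T = smooth_vf_reeb[of U] and t = reeb_tangent[of p]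
    note product = metric_connection_product[OF levi_civita_metric U] metric_connection_product[OF srconn_metric U]
    note tan = metric_connection_tangent[OF levi_civita_metric U] metric_connection_tangent[OF srconn_metric U]
    have JT: "u \<in> tan_sp M p \<Longrightarrow> u' \<in> tan_sp M p \<Longrightarrow>
        2 * gmet M p (Jop M p u) u' = gmet M p (levi_civita M p u (reeb M)) u' - gmet M p (levi_civita M p u' (reeb M)) u"
      and tauT: "u \<in> tan_sp M p \<Longrightarrow> u' \<in> tan_sp M p \<Longrightarrow>
        2 * gmet M p (tauop M p u) u' = gmet M p (levi_civita M p u (reeb M)) u' + gmet M p (levi_civita M p u' (reeb M)) u"
      for u u'
      using J_tau_csr unfolding J_tau_operators_def by blast+
    note unit = derivative_reeb_orthogonal_reeb[OF levi_civita_metric]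
    \<comment> \<open>Antisymmetry of the difference tensor for the pairs \<open>(T, Z)\<close>, \<open>(T, X)\<close> and \<open>(X, Z)\<close>.\<close>
    have compat:
      "gmet M p (srconn M p v (reeb M)) w + gmet M p (srconn M p v Z) (reeb M p) =
       gmet M p (levi_civita M p v (reeb M)) w + gmet M p (levi_civita M p v Z) (reeb M p)"
      "gmet M p (srconn M p w (reeb M)) v + gmet M p (srconn M p w X) (reeb M p) =
       gmet M p (levi_civita M p w (reeb M)) v + gmet M p (levi_civita M p w X) (reeb M p)"
      "gmet M p (srconn M p (reeb M p) X) w + gmet M p (srconn M p (reeb M p) Z) v =
       gmet M p (levi_civita M p (reeb M p) X) w + gmet M p (levi_civita M p (reeb M p) Z) v"
      using product(1)[OF T Z(1) v] product(2)[OF T Z(1) v]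
        product(1)[OF T X(1) w] product(2)[OF T X(1) w]
        product(1)[OF X(1) Z(1) t] product(2)[OF X(1) Z(1) t]
        gmet_sym[OF t tan(1)[OF Z(1) v]] gmet_sym[OF t tan(2)[OF Z(1) v]]
        gmet_sym[OF t tan(1)[OF X(1) w]] gmet_sym[OF t tan(2)[OF X(1) w]]
        gmet_sym[OF v tan(1)[OF Z(1) t]] gmet_sym[OF v tan(2)[OF Z(1) t]]
      by (simp_all add: X(2) Z(2))
    \<comment> \<open>The three cyclic torsion terms.  Here \<open>\<tau>(T) = J(T) = 0\<close> and \<open>J(v)\<close>, \<open>\<tau>(v)\<close> are horizontal, by
      \<open>D\<^sub>TT = 0\<close> and \<open>g(D\<^sub>uT, T) = 0\<close>.\<close>
    have "gmet M p (srconn M p v (reeb M)) w - gmet M p (srconn M p (reeb M p) X) w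
        - gmet M p (levi_civita M p v (reeb M)) w + gmet M p (levi_civita M p (reeb M p) X) w
        = - gmet M p (tauop M p v) w"
      using torsion_difference[OF U X(1) T w] tauT[OF t w] JT[OF v t] unit[OF v] reeb_geodesic[OF v]
        reeb_geodesic[OF w] unit[OF w] by (simp add: X(2) form_reeb)
    moreover have "gmet M p (srconn M p (reeb M p) Z) v - gmet M p (srconn M p w (reeb M)) v
        - gmet M p (levi_civita M p (reeb M p) Z) v + gmet M p (levi_civita M p w (reeb M)) v
        = gmet M p (tauop M p w) v"
      using torsion_difference[OF U T Z(1) v] tauT[OF t v] JT[OF t w] unit[OF v] unit[OF w]
        reeb_geodesic[OF v] reeb_geodesic[OF w] by (simp add: Z(2) form_reeb)
    moreover have "gmet M p (srconn M p w X) (reeb M p) - gmet M p (srconn M p v Z) (reeb M p)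
        - gmet M p (levi_civita M p w X) (reeb M p) + gmet M p (levi_civita M p v Z) (reeb M p)
        = 2 * gmet M p (Jop M p w) v"
      using torsion_difference[OF U Z(1) X(1) t] tauT[OF v t] tauT[OF w t] unit[OF v] unit[OF w]
        reeb_geodesic[OF v] reeb_geodesic[OF w] by (simp add: X(2) Z(2) form_reeb)
    ultimately show ?thesis using compat JT[OF w v] tauT[OF v w] tauT[OF w v] by linarith
  qed
  have "srconn M p v (reeb M) \<in> tan_sp M p"
    by (rule metric_connection_tangent[OF srconn_metric open_UNIV UNIV_I smooth_vf_reeb v])
  then show ?thesis using gmet_definite orth by blast
qed

section \<open>Covariant derivatives along a curve\<close>

text \<open>In this part, \<open>at r within I \<noteq> bot\<close> makes derivatives within \<open>I\<close> unique; it holds at every point of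
  a nondegenerate interval, endpoints included.\<close>

lemma C2_curve_velocity:
  assumes \<gamma>: "C2_curve (atlas M) \<gamma> I" and s: "s \<in> I" and lim: "\<And>r. r \<in> I \<Longrightarrow> at r within I \<noteq> bot"
    and c: "c \<in> atlas M" "\<gamma> s \<in> fst c"
  obtains d a where
    "((snd c \<circ> \<gamma>) has_vector_derivative d s) (at s within I)"
    "(d has_vector_derivative a) (at s within I)"
    "velocity (atlas M) \<gamma> I s = coord_vec (atlas M) c (\<gamma> s) (d s)"
    "\<forall>\<^sub>F r in at s within I. \<gamma> r \<in> fst c \<and> velocity (atlas M) \<gamma> I r = coord_vec (atlas M) c (\<gamma> r) (d r)"
proof -
  have cont: "continuous_on I \<gamma>" using \<gamma> unfolding C2_curve_def by blast
  obtain d1 d2 where d: "\<And>r. r \<in> I \<Longrightarrow> \<gamma> r \<in> fst c \<Longrightarrow>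
           ((snd c \<circ> \<gamma>) has_vector_derivative d1 r) (at r within I) \<and>
           (d1 has_vector_derivative d2 r) (at r within I)"
    using \<gamma> c(1) unfolding C2_curve_def by blast
  have vel: "velocity (atlas M) \<gamma> I r = coord_vec (atlas M) c (\<gamma> r) (d1 r)"
    if "r \<in> I" "\<gamma> r \<in> fst c" for r
    by (rule velocity_eq_coord_vec[OF smooth_atlas_csr c(1) that(2,1) cont _ lim])
      (use d that in auto)
  have "\<forall>\<^sub>F r in at s within I. r \<in> I \<and> \<gamma> r \<in> fst c"
    by (rule eventually_in_chart[OF smooth_atlas_csr c s cont])
  then have "\<forall>\<^sub>F r in at s within I. \<gamma> r \<in> fst c \<and>
      velocity (atlas M) \<gamma> I r = coord_vec (atlas M) c (\<gamma> r) (d1 r)"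
    by eventually_elim (simp add: vel)
  then show thesis using that[of d1 "d2 s"] d vel s c(2) by blast
qed

lemma velocity_tangent:
  assumes "C2_curve (atlas M) \<gamma> I" "s \<in> I" "\<And>r. r \<in> I \<Longrightarrow> at r within I \<noteq> bot"
  shows "velocity (atlas M) \<gamma> I s \<in> tan_sp M (\<gamma> s)"
proof -
  obtain c where c: "c \<in> atlas M" "\<gamma> s \<in> fst c" using ex_chart[OF smooth_atlas_csr] by blast
  show ?thesis
    by (rule C2_curve_velocity[OF assms c]) (use tangent_coord_vec[OF smooth_atlas_csr c] in auto)
qed

text \<open>The chart is obtained rather than given, since the coordinate expression that defines the
  acceleration uses a chosen chart.\<close>

lemma acceleration_components:
  assumes \<gamma>: "C2_curve (atlas M) \<gamma> I" and s: "s \<in> I" and lim: "\<And>r. r \<in> I \<Longrightarrow> at r within I \<noteq> bot"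
  obtains c d a where "c \<in> atlas M" "\<gamma> s \<in> fst c"
    "((snd c \<circ> \<gamma>) has_vector_derivative d s) (at s within I)"
    "\<forall>i. ((\<lambda>r. d r $ i) has_real_derivative a $ i) (at s within I)"
    "velocity (atlas M) \<gamma> I s = coord_vec (atlas M) c (\<gamma> s) (d s)"
    "\<forall>\<^sub>F r in at s within I. \<gamma> r \<in> fst c \<and> velocity (atlas M) \<gamma> I r = coord_vec (atlas M) c (\<gamma> r) (d r)"
    "acceleration M \<gamma> I s \<in> tan_sp M (\<gamma> s)"
    "\<forall>w\<in>tan_sp M (\<gamma> s). gmet M (\<gamma> s) (acceleration M \<gamma> I s) w =
      (\<Sum>i\<in>UNIV. a $ i * gmet M (\<gamma> s) (coord_field (atlas M) c i (\<gamma> s)) w)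
      + (\<Sum>i\<in>UNIV. d s $ i * gmet M (\<gamma> s)
          (srconn M (\<gamma> s) (velocity (atlas M) \<gamma> I s) (coord_field (atlas M) c i)) w)"
proof -
  let ?A = "atlas M" and ?p = "\<gamma> s" and ?v = "velocity (atlas M) \<gamma> I"
  define c where "c = chart_at M ?p"
  have c: "c \<in> ?A" "?p \<in> fst c"
    using someI_ex[of "\<lambda>c. c \<in> ?A \<and> ?p \<in> fst c"] ex_chart[OF smooth_atlas_csr, of ?p]
    unfolding c_def chart_at_def by blast+
  obtain d a where d: "((snd c \<circ> \<gamma>) has_vector_derivative d s) (at s within I)"
      and a: "(d has_vector_derivative a) (at s within I)"
      and vs: "?v s = coord_vec ?A c ?p (d s)"
      and vr: "\<forall>\<^sub>F r in at s within I. \<gamma> r \<in> fst c \<and> ?v r = coord_vec ?A c (\<gamma> r) (d r)"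
    by (rule C2_curve_velocity[OF \<gamma> s lim c]) (assumption | (rule that; assumption))+
  let ?F = "coord_field ?A c"
  note F = smooth_vf_coord_field[OF smooth_atlas_csr c(1)]
  have v_tan: "?v s \<in> tan_sp M ?p" using vs tangent_coord_vec[OF smooth_atlas_csr c] by blast
  have F_tan: "?F i ?p \<in> tan_sp M ?p" "srconn M ?p (?v s) (?F i) \<in> tan_sp M ?p" for i
    using F c metric_connection_tangent[OF srconn_metric open_chart_domain[OF smooth_atlas_csr c(1)] c(2) F v_tan]
    by (auto simp: smooth_vf_def)
  have a_i: "((\<lambda>r. d r $ i) has_real_derivative a $ i) (at s within I)" for i
    using bounded_linear.has_vector_derivative[OF bounded_linear_vec_nth a]
    by (simp add: has_real_derivative_iff_has_vector_derivative)
  have v_i: "?v s (coord c i) = d s $ i" for i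
    unfolding vs by (rule coord_vec_coord[OF smooth_atlas_csr c])
  have dv_i: "vector_derivative (\<lambda>r. ?v r (coord c i)) (at s within I) = a $ i" for i
  proof -
    have "\<forall>\<^sub>F r in at s within I. d r $ i = ?v r (coord c i)"
      using vr by eventually_elim (simp add: coord_vec_coord[OF smooth_atlas_csr c(1)])
    from has_field_derivative_cong_eventually[OF this v_i[symmetric]] a_i
    have "((\<lambda>r. ?v r (coord c i)) has_real_derivative a $ i) (at s within I)" by blast
    then show ?thesis
      using vector_derivative_within[OF lim[OF s]]
      by (simp add: has_real_derivative_iff_has_vector_derivative)
  qed
  let ?V = "\<lambda>f. \<Sum>i\<in>UNIV. a $ i * ?F i ?p f"
    and ?W = "\<lambda>f. \<Sum>i\<in>UNIV. d s $ i * srconn M ?p (?v s) (?F i) f"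
  have acc: "acceleration M \<gamma> I s = lcomb 1 ?V 1 ?W"
    unfolding acceleration_def cov_along_def Let_def c_def[symmetric] dv_i v_i lcomb_def
    by (simp add: sum.distrib)
  have V: "?V \<in> tan_sp M ?p \<and> gmet M ?p ?V w = (\<Sum>i\<in>UNIV. a $ i * gmet M ?p (?F i ?p) w)"
    if "w \<in> tan_sp M ?p" for w
    using that F_tan by (intro tangent_gmet_sum) auto
  have W: "?W \<in> tan_sp M ?p \<and>
      gmet M ?p ?W w = (\<Sum>i\<in>UNIV. d s $ i * gmet M ?p (srconn M ?p (?v s) (?F i)) w)"
    if "w \<in> tan_sp M ?p" for w
    using that F_tan by (intro tangent_gmet_sum) auto
  note V_tan = V[OF v_tan, THEN conjunct1] and W_tan = W[OF v_tan, THEN conjunct1]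
  have "gmet M ?p (acceleration M \<gamma> I s) w = (\<Sum>i\<in>UNIV. a $ i * gmet M ?p (?F i ?p) w)
      + (\<Sum>i\<in>UNIV. d s $ i * gmet M ?p (srconn M ?p (?v s) (?F i)) w)"
    if w: "w \<in> tan_sp M ?p" for w
    unfolding acc gmet_lcomb[OF V_tan W_tan w] using V[OF w] W[OF w] by simp
  moreover have "acceleration M \<gamma> I s \<in> tan_sp M ?p"
    unfolding acc by (rule lcomb_tangent[OF smooth_atlas_csr V_tan W_tan])
  ultimately show thesis using that c d a_i vs vr by blast
qed

text \<open>\<open>d/ds g(\<gamma>', Y) = g(\<nabla>\<^bsub>\<gamma>'\<^esub>\<gamma>', Y) + g(\<gamma>', \<nabla>\<^bsub>\<gamma>'\<^esub>Y)\<close> for a field \<open>Y\<close> on the manifold: in a chart,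
  \<open>g(\<gamma>', Y) = \<Sum>\<^sub>i \<gamma>\<^sub>i' g(\<partial>\<^sub>i, Y)\<close> near \<open>s\<close>, and the metric property of \<open>\<nabla>\<close> gives the derivatives of
  the functions \<open>g(\<partial>\<^sub>i, Y)\<close> along \<open>\<gamma>\<close>.\<close>

lemma has_derivative_gmet_velocity:
  assumes \<gamma>: "C2_curve (atlas M) \<gamma> I" and s: "s \<in> I" and lim: "\<And>r. r \<in> I \<Longrightarrow> at r within I \<noteq> bot"
    and U: "open U" "\<gamma> s \<in> U" and Y: "smooth_vf (atlas M) U Y"
  shows "((\<lambda>r. gmet M (\<gamma> r) (velocity (atlas M) \<gamma> I r) (Y (\<gamma> r))) has_real_derivative
        gmet M (\<gamma> s) (acceleration M \<gamma> I s) (Y (\<gamma> s))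
        + gmet M (\<gamma> s) (velocity (atlas M) \<gamma> I s) (srconn M (\<gamma> s) (velocity (atlas M) \<gamma> I s) Y))
        (at s within I)"
proof -
  let ?A = "atlas M" and ?p = "\<gamma> s" and ?v = "velocity (atlas M) \<gamma> I"
  have cont: "continuous_on I \<gamma>" using \<gamma> unfolding C2_curve_def by blast
  obtain c d a where c: "c \<in> ?A" "?p \<in> fst c"
      and d: "((snd c \<circ> \<gamma>) has_vector_derivative d s) (at s within I)"
      and a_i: "\<forall>i. ((\<lambda>r. d r $ i) has_real_derivative a $ i) (at s within I)"
      and vs: "?v s = coord_vec ?A c ?p (d s)"
      and vr: "\<forall>\<^sub>F r in at s within I. \<gamma> r \<in> fst c \<and> ?v r = coord_vec ?A c (\<gamma> r) (d r)"
      and acc: "\<forall>w\<in>tan_sp M ?p. gmet M ?p (acceleration M \<gamma> I s) w =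
        (\<Sum>i\<in>UNIV. a $ i * gmet M ?p (coord_field ?A c i ?p) w)
        + (\<Sum>i\<in>UNIV. d s $ i * gmet M ?p (srconn M ?p (?v s) (coord_field ?A c i)) w)"
    by (rule acceleration_components[OF \<gamma> s lim]) (assumption | (rule that; assumption))+
  let ?F = "coord_field ?A c"
  define W where "W = U \<inter> fst c"
  have W: "open W" "?p \<in> W"
    unfolding W_def using U c open_chart_domain[OF smooth_atlas_csr c(1)] by auto
  have F: "smooth_vf ?A W (?F i)" for i
    by (rule smooth_vf_subset[OF smooth_atlas_csr smooth_vf_coord_field[OF smooth_atlas_csr c(1)]])
      (simp add: W_def)
  have YW: "smooth_vf ?A W Y"
    by (rule smooth_vf_subset[OF smooth_atlas_csr Y]) (simp add: W_def)
  have v_tan: "?v s \<in> tan_sp M ?p" using vs tangent_coord_vec[OF smooth_atlas_csr c] by blast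
  have F_tan: "?F i q \<in> tan_sp M q" "Y q \<in> tan_sp M q" if "q \<in> W" for i q
    using F YW that by (auto simp: smooth_vf_def)
  have v_expand: "gmet M q (coord_vec ?A c q \<xi>) w = (\<Sum>i\<in>UNIV. \<xi> $ i * gmet M q (?F i q) w)"
    if "q \<in> W" "w \<in> tan_sp M q" for q w \<xi>
  proof -
    have "q \<in> fst c" using that(1) by (simp add: W_def)
    then show ?thesis
      using tangent_gmet_sum[of UNIV "\<lambda>i. ?F i q" q w "\<lambda>i. \<xi> $ i"] F_tan(1)[OF that(1)] that(2)
      by (simp add: coord_vec_expand[OF smooth_atlas_csr c(1)])
  qed
  have G: "((\<lambda>r. gmet M (\<gamma> r) (?F i (\<gamma> r)) (Y (\<gamma> r))) has_real_derivative
      gmet M ?p (srconn M ?p (?v s) (?F i)) (Y ?p) + gmet M ?p (?F i ?p) (srconn M ?p (?v s) Y))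
      (at s within I)" for i
  proof -
    have "smooth_near ?A ?p (\<lambda>q. gmet M q (?F i q) (Y q))"
      unfolding smooth_near_def using smooth_gmet[OF W(1) F YW] W by blast
    from has_derivative_along_curve[OF smooth_atlas_csr c s cont d this]
    show ?thesis
      using metric_connection_product[OF srconn_metric W F YW v_tan] unfolding vs[symmetric]
      by (simp add: comp_def)
  qed
  have "((\<lambda>r. \<Sum>i\<in>UNIV. d r $ i * gmet M (\<gamma> r) (?F i (\<gamma> r)) (Y (\<gamma> r))) has_real_derivative
      (\<Sum>i\<in>UNIV. a $ i * gmet M ?p (?F i ?p) (Y ?p) + (gmet M ?p (srconn M ?p (?v s) (?F i)) (Y ?p)
        + gmet M ?p (?F i ?p) (srconn M ?p (?v s) Y)) * d s $ i)) (at s within I)"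
    by (intro DERIV_sum DERIV_mult a_i[rule_format] G)
  also have "(\<Sum>i\<in>UNIV. a $ i * gmet M ?p (?F i ?p) (Y ?p) + (gmet M ?p (srconn M ?p (?v s) (?F i)) (Y ?p)
        + gmet M ?p (?F i ?p) (srconn M ?p (?v s) Y)) * d s $ i) =
      gmet M ?p (acceleration M \<gamma> I s) (Y ?p) + gmet M ?p (?v s) (srconn M ?p (?v s) Y)"
  proof -
    have "gmet M ?p (?v s) (srconn M ?p (?v s) Y) =
        (\<Sum>i\<in>UNIV. d s $ i * gmet M ?p (?F i ?p) (srconn M ?p (?v s) Y))"
      using v_expand[OF W(2) metric_connection_tangent[OF srconn_metric W YW v_tan], of "d s"]
      unfolding vs[symmetric] .
    then show ?thesis
      by (simp add: acc[rule_format, OF F_tan(2)[OF W(2)]] sum.distrib[symmetric] algebra_simps)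
  qed
  finally have deriv: "((\<lambda>r. \<Sum>i\<in>UNIV. d r $ i * gmet M (\<gamma> r) (?F i (\<gamma> r)) (Y (\<gamma> r)))
      has_real_derivative gmet M ?p (acceleration M \<gamma> I s) (Y ?p)
        + gmet M ?p (?v s) (srconn M ?p (?v s) Y)) (at s within I)" .
  have expand: "(\<Sum>i\<in>UNIV. d r $ i * gmet M (\<gamma> r) (?F i (\<gamma> r)) (Y (\<gamma> r))) =
      gmet M (\<gamma> r) (?v r) (Y (\<gamma> r))"
    if "\<gamma> r \<in> W" "?v r = coord_vec ?A c (\<gamma> r) (d r)" for r
    unfolding that(2) using v_expand[OF that(1) F_tan(2)[OF that(1)]] by simp
  have "(\<gamma> \<longlongrightarrow> ?p) (at s within I)" using cont s by (simp add: continuous_on)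
  then have "\<forall>\<^sub>F r in at s within I. \<gamma> r \<in> W"
    using topological_tendstoD W by blast
  with vr have "\<forall>\<^sub>F r in at s within I.
      (\<Sum>i\<in>UNIV. d r $ i * gmet M (\<gamma> r) (?F i (\<gamma> r)) (Y (\<gamma> r))) = gmet M (\<gamma> r) (?v r) (Y (\<gamma> r))"
    by eventually_elim (simp add: expand)
  from has_field_derivative_cong_eventually[OF this expand[OF W(2) vs]] deriv
  show ?thesis by blast
qed

text \<open>The product rule for \<open>g(\<gamma>', \<gamma>') = \<Sum>\<^sub>j \<gamma>\<^sub>j' g(\<gamma>', \<partial>\<^sub>j)\<close>, whose second factors are covered by the
  previous lemma.\<close>

lemma has_derivative_speed:
  assumes \<gamma>: "C2_curve (atlas M) \<gamma> I" and s: "s \<in> I" and lim: "\<And>r. r \<in> I \<Longrightarrow> at r within I \<noteq> bot"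
  shows "((\<lambda>r. gmet M (\<gamma> r) (velocity (atlas M) \<gamma> I r) (velocity (atlas M) \<gamma> I r)) has_real_derivative
      2 * gmet M (\<gamma> s) (acceleration M \<gamma> I s) (velocity (atlas M) \<gamma> I s)) (at s within I)"
proof -
  let ?A = "atlas M" and ?p = "\<gamma> s" and ?v = "velocity (atlas M) \<gamma> I" and ?a = "acceleration M \<gamma> I s"
  obtain c d a where c: "c \<in> ?A" "?p \<in> fst c"
      and a_i: "\<forall>i. ((\<lambda>r. d r $ i) has_real_derivative a $ i) (at s within I)"
      and vs: "?v s = coord_vec ?A c ?p (d s)"
      and vr: "\<forall>\<^sub>F r in at s within I. \<gamma> r \<in> fst c \<and> ?v r = coord_vec ?A c (\<gamma> r) (d r)"
      and acc_tan: "?a \<in> tan_sp M ?p"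
      and acc: "\<forall>w\<in>tan_sp M ?p. gmet M ?p ?a w =
        (\<Sum>i\<in>UNIV. a $ i * gmet M ?p (coord_field ?A c i ?p) w)
        + (\<Sum>i\<in>UNIV. d s $ i * gmet M ?p (srconn M ?p (?v s) (coord_field ?A c i)) w)"
    by (rule acceleration_components[OF \<gamma> s lim]) (assumption | (rule that; assumption))+
  let ?F = "coord_field ?A c"
  note U = open_chart_domain[OF smooth_atlas_csr c(1)]
  note F = smooth_vf_coord_field[OF smooth_atlas_csr c(1)]
  have F_tan: "?F i q \<in> tan_sp M q" if "q \<in> fst c" for i q
    using F that by (auto simp: smooth_vf_def)
  have v_tan: "?v s \<in> tan_sp M ?p" using vs tangent_coord_vec[OF smooth_atlas_csr c] by blast
  note dF_tan = metric_connection_tangent[OF srconn_metric U c(2) F v_tan]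
  have v_expand: "gmet M q w (coord_vec ?A c q \<xi>) = (\<Sum>i\<in>UNIV. \<xi> $ i * gmet M q w (?F i q))"
    if q: "q \<in> fst c" and w: "w \<in> tan_sp M q" for q w \<xi>
  proof -
    have "coord_vec ?A c q \<xi> \<in> tan_sp M q" using tangent_coord_vec[OF smooth_atlas_csr c(1) q] by blast
    then have "gmet M q w (coord_vec ?A c q \<xi>) = gmet M q (coord_vec ?A c q \<xi>) w"
      by (rule gmet_sym[OF w])
    then show ?thesis
      using tangent_gmet_sum[of UNIV "\<lambda>i. ?F i q" q w "\<lambda>i. \<xi> $ i"] F_tan[OF q] w
      by (simp add: coord_vec_expand[OF smooth_atlas_csr c(1) q] gmet_sym[OF w])
  qed
  have "((\<lambda>r. \<Sum>i\<in>UNIV. d r $ i * gmet M (\<gamma> r) (?v r) (?F i (\<gamma> r))) has_real_derivative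
      (\<Sum>i\<in>UNIV. a $ i * gmet M ?p (?v s) (?F i ?p) + (gmet M ?p ?a (?F i ?p)
        + gmet M ?p (?v s) (srconn M ?p (?v s) (?F i))) * d s $ i)) (at s within I)"
    by (intro DERIV_sum DERIV_mult a_i[rule_format] has_derivative_gmet_velocity[OF \<gamma> s lim U c(2) F])
  also have "(\<Sum>i\<in>UNIV. a $ i * gmet M ?p (?v s) (?F i ?p) + (gmet M ?p ?a (?F i ?p)
        + gmet M ?p (?v s) (srconn M ?p (?v s) (?F i))) * d s $ i) = 2 * gmet M ?p ?a (?v s)"
  proof -
    have "gmet M ?p ?a (?v s) = (\<Sum>i\<in>UNIV. d s $ i * gmet M ?p ?a (?F i ?p))"
      using v_expand[OF c(2) acc_tan, of "d s"] unfolding vs[symmetric] .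
    moreover have "gmet M ?p ?a (?v s) = (\<Sum>i\<in>UNIV. a $ i * gmet M ?p (?v s) (?F i ?p))
        + (\<Sum>i\<in>UNIV. d s $ i * gmet M ?p (?v s) (srconn M ?p (?v s) (?F i)))"
      unfolding acc[rule_format, OF v_tan] gmet_sym[OF v_tan F_tan[OF c(2)]] gmet_sym[OF v_tan dF_tan] ..
    ultimately show ?thesis by (simp add: sum.distrib algebra_simps)
  qed
  finally have deriv: "((\<lambda>r. \<Sum>i\<in>UNIV. d r $ i * gmet M (\<gamma> r) (?v r) (?F i (\<gamma> r))) has_real_derivative
      2 * gmet M ?p ?a (?v s)) (at s within I)" .
  have expand: "(\<Sum>i\<in>UNIV. d r $ i * gmet M (\<gamma> r) (?v r) (?F i (\<gamma> r))) = gmet M (\<gamma> r) (?v r) (?v r)"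
    if "\<gamma> r \<in> fst c" "?v r = coord_vec ?A c (\<gamma> r) (d r)" for r
  proof -
    have "?v r \<in> tan_sp M (\<gamma> r)"
      using that(2) tangent_coord_vec[OF smooth_atlas_csr c(1) that(1)] by blast
    from v_expand[OF that(1) this, of "d r"] show ?thesis unfolding that(2)[symmetric] by simp
  qed
  have "\<forall>\<^sub>F r in at s within I.
      (\<Sum>i\<in>UNIV. d r $ i * gmet M (\<gamma> r) (?v r) (?F i (\<gamma> r))) = gmet M (\<gamma> r) (?v r) (?v r)"
    using vr by eventually_elim (use expand in blast)
  from has_field_derivative_cong_eventually[OF this expand[OF c(2) vs]] deriv
  show ?thesis by blast
qed

text \<open>Unit speed makes the acceleration orthogonal to the velocity, and \<open>g(\<gamma>', T) = 0\<close> with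
  \<open>\<nabla>T = 0\<close> makes it horizontal.\<close>

lemma acceleration_orthogonal:
  assumes \<gamma>: "C2_curve (atlas M) \<gamma> I" and s: "s \<in> I" and lim: "\<And>r. r \<in> I \<Longrightarrow> at r within I \<noteq> bot"
    and horizontal: "\<And>r. r \<in> I \<Longrightarrow> form M (\<gamma> r) (velocity (atlas M) \<gamma> I r) = 0"
    and unit: "\<And>r. r \<in> I \<Longrightarrow> gnorm M (\<gamma> r) (velocity (atlas M) \<gamma> I r) = 1"
  shows "acceleration M \<gamma> I s \<in> tan_sp M (\<gamma> s)"
    and "gmet M (\<gamma> s) (acceleration M \<gamma> I s) (reeb M (\<gamma> s)) = 0"
    and "gmet M (\<gamma> s) (acceleration M \<gamma> I s) (velocity (atlas M) \<gamma> I s) = 0"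
proof -
  let ?v = "velocity (atlas M) \<gamma> I" and ?a = "acceleration M \<gamma> I s"
  have v_tan: "?v r \<in> tan_sp M (\<gamma> r)" if "r \<in> I" for r
    by (rule velocity_tangent[OF \<gamma> that lim])
  have const: "D = 0"
    if "(h has_real_derivative D) (at s within I)" "\<And>r. r \<in> I \<Longrightarrow> h r = k" for h D k
  proof -
    have "\<forall>\<^sub>F r in at s within I. k = h r"
      by (simp add: eventually_at_filter that(2))
    from has_field_derivative_cong_eventually[OF this that(2)[OF s, symmetric]] DERIV_const
    have "(h has_real_derivative 0) (at s within I)" by blast
    then show ?thesis using has_field_derivative_unique[OF that(1) _ lim[OF s]] by blast
  qed
  show "?a \<in> tan_sp M (\<gamma> s)" by (rule acceleration_components[OF \<gamma> s lim])
  have "gmet M (\<gamma> s) ?a (reeb M (\<gamma> s)) + gmet M (\<gamma> s) (?v s) (srconn M (\<gamma> s) (?v s) (reeb M)) = 0"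
    by (rule const[OF has_derivative_gmet_velocity[OF \<gamma> s lim open_UNIV UNIV_I smooth_vf_reeb], of 0])
      (auto simp: gmet_reeb_right v_tan horizontal)
  moreover have "gmet M (\<gamma> s) (?v s) (\<lambda>f. 0) = 0"
    using gmet_sym[OF v_tan[OF s] zero_tangent[OF smooth_atlas_csr]] gmet_zero[OF v_tan[OF s]] by simp
  ultimately show "gmet M (\<gamma> s) ?a (reeb M (\<gamma> s)) = 0"
    by (simp add: reeb_parallel[OF v_tan[OF s]])
  have "2 * gmet M (\<gamma> s) ?a (?v s) = 0"
    by (rule const[OF has_derivative_speed[OF \<gamma> s lim], of 1])
      (use unit in \<open>auto simp: gnorm_def\<close>)
  then show "gmet M (\<gamma> s) ?a (?v s) = 0" by simp
qed

end

section \<open>Characteristic curves\<close>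

theorem proposition5p5:
  fixes M :: "('m::{t2_space, second_countable_topology}) csr"
    and \<Omega> E :: "'m set" and f H :: "'m \<Rightarrow> real" and N \<nu> :: "'m vfield"
    and \<gamma> :: "real \<Rightarrow> 'm" and I :: "real set"
  assumes "contact_sub_riemannian M"
    and "open \<Omega>" and "connected \<Omega>" and "\<Omega> \<noteq> {}"
    and "continuous_on \<Omega> f"
    and "prescribed_mean_curvature M \<Omega> E f"
    and "lipschitz_boundary M \<Omega> E"
    and "unit_normal M \<Omega> E N"
    and "horizontal_unit_normal M \<Omega> E N \<nu>"
    and "mean_curvature M \<Omega> E \<nu> H"
    and "characteristic_curve M \<Omega> E \<nu> \<gamma> I"
  shows "nabla_geodesic M \<gamma> I
           (\<lambda>s. H (\<gamma> s) / gnorm M (\<gamma> s) (Jop M (\<gamma> s) (velocity (atlas M) \<gamma> I s)))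
         \<and> (J_isometric M \<longrightarrow> nabla_geodesic M \<gamma> I (\<lambda>s. H (\<gamma> s)))"
proof -
  note csr = assms(1)
  let ?v = "velocity (atlas M) \<gamma> I"
  have interval: "is_interval I" and ab: "\<exists>a\<in>I. \<exists>b\<in>I. a < b" and C2: "C2_curve (atlas M) \<gamma> I"
    and pointwise: "\<And>s. s \<in> I \<Longrightarrow> \<gamma> s \<in> bdry \<Omega> E - singular_set M \<Omega> E \<and>
        form M (\<gamma> s) (?v s) = 0 \<and> gnorm M (\<gamma> s) (?v s) = 1 \<and>
        (\<exists>k>0. \<nu> (\<gamma> s) = (\<lambda>f. - k * Jop M (\<gamma> s) (?v s) f))"
    using assms(11) unfolding characteristic_curve_def by blast+
  have lim: "at r within I \<noteq> bot" if "r \<in> I" for r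
  proof -
    have "I \<noteq> {x}" for x using ab by auto
    then have "r islimpt I"
      using connected_imp_perfect is_interval_connected interval that by blast
    then show ?thesis by (simp add: trivial_limit_within)
  qed
  have main: "lcomb 1 (acceleration M \<gamma> I s) (H (\<gamma> s) / gnorm M (\<gamma> s) (Jop M (\<gamma> s) (?v s)))
      (Jop M (\<gamma> s) (?v s)) = (\<lambda>f. 0)" if s: "s \<in> I" for s
  proof -
    let ?p = "\<gamma> s" and ?a = "acceleration M \<gamma> I s" and ?J = "Jop M (\<gamma> s) (?v s)" and ?T = "reeb M (\<gamma> s)"
    obtain k where k: "k > 0" and \<nu>_J: "\<nu> ?p = (\<lambda>f. - k * ?J f)" using pointwise[OF s] by blast
    have \<nu>: "\<nu> ?p \<in> horiz M ?p" "gnorm M ?p (\<nu> ?p) = 1"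
      using assms(9) pointwise[OF s] unfolding horizontal_unit_normal_def by blast+
    have \<nu>_tan: "\<nu> ?p \<in> tan_sp M ?p" and \<nu>_form: "form M ?p (\<nu> ?p) = 0"
      using \<nu>(1) by (simp_all add: horiz_def)
    have v_tan: "?v s \<in> tan_sp M ?p" by (rule velocity_tangent[OF csr C2 s lim])
    have J_tan: "?J \<in> tan_sp M ?p"
      using J_tau_csr[OF csr] v_tan unfolding J_tau_operators_def by blast
    have acc: "?a \<in> tan_sp M ?p" "gmet M ?p ?a ?T = 0" "gmet M ?p ?a (?v s) = 0"
      using acceleration_orthogonal[OF csr C2 s lim] pointwise by blast+
    have "\<nu> ?p = lcomb (- k) ?J 0 ?J" unfolding \<nu>_J lcomb_def by simp
    then have g_\<nu>: "gmet M ?p (\<nu> ?p) w = - k * gmet M ?p ?J w" if "w \<in> tan_sp M ?p" for w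
      by (simp add: gmet_lcomb[OF csr J_tan J_tan that])
    have "2 * gmet M ?p ?J (?v s) = 0"
      using J_tau_csr[OF csr] v_tan unfolding J_tau_operators_def by fastforce
    then have \<nu>_v: "gmet M ?p (\<nu> ?p) (?v s) = 0" by (simp add: g_\<nu>[OF v_tan])
    have units: "gmet M ?p (\<nu> ?p) (\<nu> ?p) = 1" "gmet M ?p (?v s) (?v s) = 1"
      using \<nu>(2) pointwise[OF s] by (simp_all add: gnorm_def)
    let ?e = "\<lambda>i::3. if i = 1 then ?T else if i = 2 then ?v s else \<nu> ?p"
    let ?b = "lcomb 1 ?a (- H ?p) (\<nu> ?p)"
    have T_tan: "?T \<in> tan_sp M ?p" by (rule reeb_tangent[OF csr])
    have H: "H ?p = gmet M ?p ?a (\<nu> ?p)"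
      using assms(10,11) s unfolding mean_curvature_def by blast
    \<comment> \<open>The difference of the acceleration and its \<open>\<nu>\<close>-component is orthogonal to the whole basis.\<close>
    have b: "?b = (\<lambda>f. 0)"
    proof (rule orthonormal_complete[OF csr, of ?e ?p])
      show "?e i \<in> tan_sp M ?p" for i using T_tan v_tan \<nu>_tan by simp
      show "gmet M ?p (?e i) (?e j) = (if i = j then 1 else 0)" for i j
        using exhaust_3[of i] exhaust_3[of j] units \<nu>_v gmet_sym[OF csr \<nu>_tan v_tan] pointwise[OF s]
        by (auto simp: gmet_reeb[OF csr] gmet_reeb_right[OF csr] form_reeb[OF csr] T_tan v_tan \<nu>_tan \<nu>_form)
      show "?b \<in> tan_sp M ?p"
        by (rule lcomb_tangent[OF smooth_atlas_csr[OF csr] acc(1) \<nu>_tan])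
      show "gmet M ?p ?b (?e j) = 0" for j
        using acc \<nu>_v H units
        by (simp add: gmet_lcomb[OF csr acc(1) \<nu>_tan] T_tan v_tan \<nu>_tan gmet_reeb_right[OF csr] \<nu>_form)
    qed
    have norm_J: "gnorm M ?p ?J = 1 / k"
    proof -
      have "1 = k * (k * gmet M ?p ?J ?J)"
        using g_\<nu>[OF J_tan] g_\<nu>[OF \<nu>_tan] gmet_sym[OF csr J_tan \<nu>_tan] units(1) by simp
      then have "gmet M ?p ?J ?J = (1 / k)\<^sup>2" using k by (simp add: field_simps power2_eq_square)
      then show ?thesis using k by (simp add: gnorm_def real_sqrt_abs)
    qed
    show ?thesis
    proof
      fix f
      show "lcomb 1 ?a (H ?p / gnorm M ?p ?J) ?J f = 0"
        using fun_cong[OF b, of f] unfolding lcomb_def norm_J \<nu>_J by (simp add: algebra_simps)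
    qed
  qed
  have "nabla_geodesic M \<gamma> I (\<lambda>s. H (\<gamma> s) / gnorm M (\<gamma> s) (Jop M (\<gamma> s) (?v s)))"
    unfolding nabla_geodesic_def using main by blast
  moreover have "nabla_geodesic M \<gamma> I (\<lambda>s. H (\<gamma> s))" if "J_isometric M"
    unfolding nabla_geodesic_def
  proof
    fix s assume s: "s \<in> I"
    have "?v s \<in> horiz M (\<gamma> s)"
      using velocity_tangent[OF csr C2 s lim] pointwise[OF s] by (simp add: horiz_def)
    then have "gnorm M (\<gamma> s) (Jop M (\<gamma> s) (?v s)) = 1"
      using that pointwise[OF s] by (simp add: J_isometric_def)
    then show "lcomb 1 (acceleration M \<gamma> I s) (H (\<gamma> s)) (Jop M (\<gamma> s) (?v s)) = (\<lambda>f. 0)"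
      using main[OF s] by simp
  qed
  ultimately show ?thesis by blast
qed

end
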